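(* Let $n\ge3$, $\mu_1,\mu_2,\beta>0$, $p=2q+1$ with $\frac{n}{n-2}<p\le\frac{n+2}{n-2}$, and let $(u,v)$ be a positive solution of (S) with $\limsup_{|x|\to0}u(x)=+\infty$ or $\limsup_{|x|\to0}v(x)=+\infty$. Then $u$ and $v$ are radially symmetric about the origin and strictly decreasing in $r=|x|>0$.
   Context: System (S): $-\Delta u=\mu_1u^{2q+1}+\beta u^qv^{q+1}$, $-\Delta v=\mu_2v^{2q+1}+\beta v^qu^{q+1}$ in $\mathbb{R}^n\setminus\{0\}$; a positive solution is a pair $u,v\in C^2(\mathbb{R}^n\setminus\{0\})$, $u,v>0$, solving (S). *)

theory Defs
  imports "HOL-Analysis.Analysis" "HOL-Library.Liminf_Limsup"
begin

definition pd :: "'n::finite \<Rightarrow> (real^'n \<Rightarrow> real) \<Rightarrow> real^'n \<Rightarrow> real" where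
  "pd i f x = frechet_derivative f (at x) (axis i 1)"

definition C2_on :: "(real^'n::finite) set \<Rightarrow> (real^'n \<Rightarrow> real) \<Rightarrow> bool" where
  "C2_on S f \<longleftrightarrow> f differentiable_on S \<and> (\<forall>i. pd i f differentiable_on S)
     \<and> (\<forall>i j. continuous_on S (pd j (pd i f)))"

definition lap :: "(real^'n::finite \<Rightarrow> real) \<Rightarrow> real^'n \<Rightarrow> real" where
  "lap f x = (\<Sum>i\<in>UNIV. pd i (pd i f) x)"

end

theory Submission
  imports Defs
begin

text \<open>
  Moving spheres. Centre a sphere of radius \<open>\<rho>\<close> at a point \<open>x \<noteq> 0\<close> with \<open>\<rho> < norm x\<close>, so that the
  singularity lies outside. Since \<open>2 * q + 1 \<le> (n + 2) / (n - 2)\<close> and the system is cooperative,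
  the gaps between \<open>u\<close>, \<open>v\<close> and their Kelvin transforms are superharmonic outside the sphere as long
  as they are nonnegative. The gap of the unbounded component cannot vanish identically, because the
  Kelvin transform is bounded near the singularity; the coupling then makes the other gap positive too.
  The Hopf lemma and lower bounds by the fundamental solution (for which the puncture is removable)
  let the radius grow past any admissible value, hence up to \<open>norm x\<close>. Spheres that
  degenerate to half spaces turn the Kelvin inequality into \<open>u b \<le> u a\<close> whenever
  \<open>0 < norm a < norm b\<close>, which gives symmetry by continuity, and strictness because
  \<open>u\<close> is nowhere harmonic.
\<close>

subsection \<open>Partial derivatives and the Laplacian\<close>

text \<open>At the critical exponent the system is invariant under Kelvin transforms, so the
  exponent yields no strict inequality, and strictness must be drawn from the singularity at every
  radius anew. The admissible radii are shown to form a nonempty, open and closed subset of an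
  interval. Openness is the delicate point: the exterior of the sphere is unbounded and punctured,
  so under a small change of the radius a violation could appear far out, near the puncture, or at
  the sphere itself, where both sides agree. A lower bound for the gap of order
  \<open>norm y powr (2 - n)\<close>, which is also the decay rate of the Kelvin transform, excludes
  the first two; the sign of the radial derivative excludes the third. Each centre is translated to
  the origin, so that the singularity becomes a point \<open>z\<close>.\<close>

lemma pd_eqI:
  assumes "(f has_derivative f') (at x)"
  shows "pd i f x = f' (axis i 1)"
  using frechet_derivative_at[OF assms] by (simp add: pd_def)

lemma has_derivative_pd:
  fixes f :: "real^'n::finite \<Rightarrow> real"
  assumes "f differentiable (at x)"
  shows "(f has_derivative (\<lambda>h. \<Sum>i\<in>UNIV. h $ i * pd i f x)) (at x)"
proof -
  let ?f' = "frechet_derivative f (at x)"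
  have d: "(f has_derivative ?f') (at x)"
    using assms frechet_derivative_works by blast
  have lin: "linear ?f'"
    using d has_derivative_linear by blast
  have "?f' h = (\<Sum>i\<in>UNIV. h $ i * pd i f x)" for h
  proof -
    have "?f' h = ?f' (\<Sum>i\<in>UNIV. h $ i *\<^sub>R axis i 1)"
      using basis_expansion[of h] by (simp add: scalar_mult_eq_scaleR)
    also have "\<dots> = (\<Sum>i\<in>UNIV. h $ i * pd i f x)"
      by (simp add: linear_sum[OF lin] linear_cmul[OF lin] pd_def)
    finally show ?thesis .
  qed
  then show ?thesis
    using d by (metis (no_types, lifting) ext)
qed

text \<open>\<open>frechet_derivative\<close> is a Hilbert choice among the derivatives, so the same
  set of candidates gives the same choice, even where neither function is differentiable.\<close>

lemma pd_cong:
  assumes "open S" "x \<in> S" "\<And>y. y \<in> S \<Longrightarrow> f y = g y"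
  shows "pd i f x = pd i g x"
proof -
  have "(f has_derivative f') (at x) \<longleftrightarrow> (g has_derivative f') (at x)" for f'
    using assms by (metis has_derivative_transform_within_open)
  then show ?thesis
    by (simp add: pd_def frechet_derivative_def)
qed

lemma differentiable_cong:
  assumes "open S" "x \<in> S" "\<And>y. y \<in> S \<Longrightarrow> f y = g y" "f differentiable (at x)"
  shows "g differentiable (at x)"
  using assms by (metis differentiable_def has_derivative_transform_within_open)

lemma lap_cong:
  assumes "open S" "x \<in> S" "\<And>y. y \<in> S \<Longrightarrow> f y = g y"
  shows "lap f x = lap g x"
proof -
  have "pd i f y = pd i g y" if "y \<in> S" for i y
    using pd_cong[OF assms(1) that assms(3)] .
  then have "pd i (pd i f) x = pd i (pd i g) x" for i
    using pd_cong[OF assms(1,2)] by blast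
  then show ?thesis
    by (simp add: lap_def)
qed

lemma pd_const: "pd i (\<lambda>x. c) x = 0"
  by (rule trans[OF pd_eqI[OF has_derivative_const]]) simp

lemma pd_add:
  assumes "f differentiable (at x)" "g differentiable (at x)"
  shows "pd i (\<lambda>x. f x + g x) x = pd i f x + pd i g x"
  using pd_eqI[OF has_derivative_add[OF assms[THEN has_derivative_pd]], of i]
    pd_eqI[OF assms(1)[THEN has_derivative_pd], of i] pd_eqI[OF assms(2)[THEN has_derivative_pd], of i]
  by simp

lemma pd_mult:
  assumes "f differentiable (at x)" "g differentiable (at x)"
  shows "pd i (\<lambda>x. f x * g x) x = f x * pd i g x + pd i f x * g x"
  using pd_eqI[OF has_derivative_mult[OF assms[THEN has_derivative_pd]], of i]
    pd_eqI[OF assms(1)[THEN has_derivative_pd], of i] pd_eqI[OF assms(2)[THEN has_derivative_pd], of i]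
  by simp

lemma pd_cmult:
  assumes "f differentiable (at x)"
  shows "pd i (\<lambda>x. c * f x) x = c * pd i f x"
  using pd_mult[OF differentiable_const assms, of i c] by (simp add: pd_const)

lemma pd_sum:
  assumes "finite J" "\<And>j. j \<in> J \<Longrightarrow> f j differentiable (at x)"
  shows "pd i (\<lambda>x. \<Sum>j\<in>J. f j x) x = (\<Sum>j\<in>J. pd i (f j) x)"
  using assms
proof (induction J rule: finite_induct)
  case empty
  then show ?case by (simp add: pd_const)
next
  case (insert j J)
  have "(\<lambda>x. \<Sum>j\<in>J. f j x) differentiable (at x)"
    using insert by (intro differentiable_sum) auto
  then show ?case
    using insert by (simp add: pd_add)
qed

lemma pd_compose:
  fixes f :: "real^'n::finite \<Rightarrow> real"
  assumes "(T has_derivative T') (at x)" "f differentiable (at (T x))"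
  shows "pd i (\<lambda>x. f (T x)) x = (\<Sum>j\<in>UNIV. T' (axis i 1) $ j * pd j f (T x))"
  using pd_eqI[OF has_derivative_compose[OF assms(1) has_derivative_pd[OF assms(2)]], of i] by simp

lemma has_derivative_shift: "((\<lambda>x. x + a) has_derivative (\<lambda>h. h)) (at x)"
  by (auto intro!: derivative_eq_intros)

lemma differentiable_shift:
  fixes f :: "'a::real_normed_vector \<Rightarrow> 'b::real_normed_vector"
  assumes "f differentiable (at (x + a))"
  shows "(\<lambda>x. f (x + a)) differentiable (at x)"
  using assms has_derivative_compose[OF has_derivative_shift] unfolding differentiable_def by blast

lemma pd_shift:
  fixes f :: "real^'n::finite \<Rightarrow> real"
  assumes "f differentiable (at (x + a))"
  shows "pd i (\<lambda>x. f (x + a)) x = pd i f (x + a)"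
  using pd_eqI[OF has_derivative_compose[OF has_derivative_shift assms[THEN has_derivative_pd]], of i]
    pd_eqI[OF assms[THEN has_derivative_pd], of i]
  by simp

text \<open>Continuity of the second derivatives is left out: the maximum principles test them at a
  single point only, and the Kelvin computation avoids the symmetry of mixed partials.\<close>

definition twice_diff :: "(real^'n::finite) set \<Rightarrow> (real^'n \<Rightarrow> real) \<Rightarrow> bool" where
  "twice_diff S f \<longleftrightarrow> (\<forall>x\<in>S. f differentiable (at x) \<and> (\<forall>i. pd i f differentiable (at x)))"

lemma twice_diffD:
  assumes "twice_diff S f" "x \<in> S"
  shows "f differentiable (at x)" "pd i f differentiable (at x)"
  using assms by (auto simp: twice_diff_def)

lemma twice_diff_subset: "twice_diff S f \<Longrightarrow> T \<subseteq> S \<Longrightarrow> twice_diff T f"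
  by (auto simp: twice_diff_def)

lemma C2_on_imp_twice_diff: "open S \<Longrightarrow> C2_on S f \<Longrightarrow> twice_diff S f"
  by (simp add: C2_on_def twice_diff_def differentiable_on_eq_differentiable_at)

lemma twice_diff_continuous_on:
  assumes "twice_diff S f"
  shows "continuous_on S f"
  using assms by (meson continuous_at_imp_continuous_on differentiable_imp_continuous_within twice_diff_def)

lemma twice_diff_continuous_on_pd:
  assumes "twice_diff S f"
  shows "continuous_on S (pd i f)"
  using assms by (meson continuous_at_imp_continuous_on differentiable_imp_continuous_within twice_diff_def)

lemma twice_diff_const: "twice_diff S (\<lambda>x::real^'n::finite. c)"
proof -
  have "pd i (\<lambda>x::real^'n. c) = (\<lambda>x. 0)" for i
    by (simp add: fun_eq_iff pd_const)
  then show ?thesis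
    by (simp add: twice_diff_def)
qed

lemma lap_const: "lap (\<lambda>x::real^'n::finite. c) x = 0"
proof -
  have "pd i (\<lambda>x::real^'n. c) = (\<lambda>x. 0)" for i
    by (simp add: fun_eq_iff pd_const)
  then show ?thesis
    by (simp add: lap_def pd_const)
qed

lemma twice_diff_lap_add:
  assumes "open S" "twice_diff S f" "twice_diff S g"
  shows "twice_diff S (\<lambda>x. f x + g x)"
    and "x \<in> S \<Longrightarrow> lap (\<lambda>x. f x + g x) x = lap f x + lap g x"
proof -
  note f = twice_diffD[OF assms(2)] and g = twice_diffD[OF assms(3)]
  have *: "pd i (\<lambda>x. f x + g x) x = pd i f x + pd i g x" if "x \<in> S" for i x
    using pd_add f(1) g(1) that by blast
  have "pd i (\<lambda>x. f x + g x) differentiable (at x)" if "x \<in> S" for i x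
    by (rule differentiable_cong[OF assms(1) that *[symmetric] differentiable_add[OF f(2) g(2)]])
      (use that in auto)
  then show "twice_diff S (\<lambda>x. f x + g x)"
    using f g by (auto simp: twice_diff_def)
  show "lap (\<lambda>x. f x + g x) x = lap f x + lap g x" if "x \<in> S"
    using pd_cong[OF assms(1) that *] pd_add[OF f(2) g(2), OF that that]
    by (simp add: lap_def sum.distrib)
qed

lemma twice_diff_lap_cmult:
  assumes "open S" "twice_diff S f"
  shows "twice_diff S (\<lambda>x. c * f x)"
    and "x \<in> S \<Longrightarrow> lap (\<lambda>x. c * f x) x = c * lap f x"
proof -
  note f = twice_diffD[OF assms(2)]
  have *: "pd i (\<lambda>x. c * f x) x = c * pd i f x" if "x \<in> S" for i x
    using pd_cmult f(1) that by blast
  have "pd i (\<lambda>x. c * f x) differentiable (at x)" if "x \<in> S" for i x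
    by (rule differentiable_cong[OF assms(1) that *[symmetric] differentiable_mult[OF differentiable_const f(2)]])
      (use that in auto)
  then show "twice_diff S (\<lambda>x. c * f x)"
    using f by (auto simp: twice_diff_def intro!: differentiable_mult)
  show "lap (\<lambda>x. c * f x) x = c * lap f x" if "x \<in> S"
    using pd_cong[OF assms(1) that *] pd_cmult[OF f(2), OF that]
    by (simp add: lap_def sum_distrib_left)
qed

lemma twice_diff_lap_diff:
  assumes "open S" "twice_diff S f" "twice_diff S g"
  shows "twice_diff S (\<lambda>x. f x - g x)"
    and "x \<in> S \<Longrightarrow> lap (\<lambda>x. f x - g x) x = lap f x - lap g x"
  using twice_diff_lap_add[OF assms(1,2) twice_diff_lap_cmult(1)[OF assms(1,3), of "-1"]]
    twice_diff_lap_cmult(2)[OF assms(1,3), of x "-1"]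
  by simp_all

lemma twice_diff_lap_shift:
  assumes "open S" "twice_diff S f" "\<And>x. x \<in> S' \<longleftrightarrow> x + a \<in> S"
  shows "twice_diff S' (\<lambda>x. f (x + a))"
    and "x + a \<in> S \<Longrightarrow> lap (\<lambda>x. f (x + a)) x = lap f (x + a)"
proof -
  note f = twice_diffD[OF assms(2)]
  have "S' = (\<lambda>x. x + a) -` S"
    using assms(3) by auto
  then have S': "open S'"
    using assms(1) by (auto intro!: open_vimage continuous_intros)
  have *: "pd i (\<lambda>x. f (x + a)) x = pd i f (x + a)" if "x \<in> S'" for i x
    using pd_shift f(1) that assms(3) by blast
  have "pd i (\<lambda>x. f (x + a)) differentiable (at x)" if "x \<in> S'" for i x
    by (rule differentiable_cong[OF S' that *[symmetric] differentiable_shift[OF f(2)]])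
      (use that assms(3) in auto)
  then show "twice_diff S' (\<lambda>x. f (x + a))"
    using f assms(3) by (auto simp: twice_diff_def intro!: differentiable_shift)
  show "lap (\<lambda>x. f (x + a)) x = lap f (x + a)" if "x + a \<in> S"
    using pd_cong[OF S' _ *] pd_shift[OF f(2)[OF that]] that assms(3)
    by (simp add: lap_def)
qed

lemma twice_diff_lap_inner:
  shows "twice_diff S (\<lambda>x::real^'n::finite. x \<bullet> x)"
    and "lap (\<lambda>x::real^'n. x \<bullet> x) x = 2 * real CARD('n)"
proof -
  have d: "((\<lambda>x::real^'n. x \<bullet> x) has_derivative (\<lambda>h. 2 * (x \<bullet> h))) (at x)" for x
    by (rule has_derivative_eq_rhs[OF has_derivative_inner[OF has_derivative_ident has_derivative_ident]])
      (simp add: inner_commute)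
  have 1: "pd i (\<lambda>x::real^'n. x \<bullet> x) = (\<lambda>x. 2 * x $ i)" for i
    using pd_eqI[OF d] by (simp add: fun_eq_iff inner_axis)
  have d2: "((\<lambda>x::real^'n. 2 * x $ i) has_derivative (\<lambda>h. 2 * h $ i)) (at x)" for x i
    by (auto intro!: derivative_eq_intros bounded_linear.has_derivative[OF bounded_linear_vec_nth])
  have 2: "pd i (\<lambda>x::real^'n. 2 * x $ i) x = 2" for i
    using pd_eqI[OF d2] by simp
  show "twice_diff S (\<lambda>x::real^'n. x \<bullet> x)"
    unfolding twice_diff_def 1 using d d2 by (auto simp: differentiable_def)
  show "lap (\<lambda>x::real^'n. x \<bullet> x) x = 2 * real CARD('n)"
    by (simp add: lap_def 1 2)
qed

subsection \<open>The Kelvin transform\<close>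

text \<open>Up to the factor \<open>k / (y \<bullet> y)\<close> the derivative is the reflection in
  the hyperplane orthogonal to \<open>y\<close>. The inversion is therefore conformal, which is what
  makes the Laplacian transform well.\<close>

lemma has_derivative_inversion:
  fixes y :: "real^'n::finite"
  assumes "y \<noteq> 0"
  shows "((\<lambda>y. (k / (y \<bullet> y)) *\<^sub>R y) has_derivative
    (\<lambda>h. (k / (y \<bullet> y)) *\<^sub>R h - (2 * k * (y \<bullet> h) / (y \<bullet> y)\<^sup>2) *\<^sub>R y)) (at y)"
  using assms
  by (auto intro!: derivative_eq_intros simp: inner_commute power2_eq_square scaleR_left_diff_distrib algebra_simps)

lemma pd_compose_inversion:
  fixes y :: "real^'n::finite"
  assumes "y \<noteq> 0" "f differentiable (at ((k / (y \<bullet> y)) *\<^sub>R y))"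
  shows "pd i (\<lambda>y. f ((k / (y \<bullet> y)) *\<^sub>R y)) y = k / (y \<bullet> y) * pd i f ((k / (y \<bullet> y)) *\<^sub>R y)
    - 2 * k * y $ i / (y \<bullet> y)\<^sup>2 * (\<Sum>j\<in>UNIV. y $ j * pd j f ((k / (y \<bullet> y)) *\<^sub>R y))"
proof -
  let ?T = "(k / (y \<bullet> y)) *\<^sub>R y"
  have *: "((k / (y \<bullet> y)) *\<^sub>R axis i 1 - (2 * k * (y \<bullet> axis i 1) / (y \<bullet> y)\<^sup>2) *\<^sub>R y) $ j * pd j f ?T
      = (if j = i then k / (y \<bullet> y) * pd j f ?T else 0) - 2 * k * y $ i / (y \<bullet> y)\<^sup>2 * (y $ j * pd j f ?T)" for j
    by (simp add: inner_axis) (simp add: axis_def algebra_simps)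
  show ?thesis
    unfolding pd_compose[OF has_derivative_inversion[OF assms(1)] assms(2)] *
    by (simp add: sum_subtractf sum_distrib_left)
qed

lemma differentiable_compose_inversion:
  fixes y :: "real^'n::finite"
  assumes "y \<noteq> 0" "f differentiable (at ((k / (y \<bullet> y)) *\<^sub>R y))"
  shows "(\<lambda>y. f ((k / (y \<bullet> y)) *\<^sub>R y)) differentiable (at y)"
  using has_derivative_compose[OF has_derivative_inversion[OF assms(1)]] assms(2)
  unfolding differentiable_def by blast

lemma has_derivative_inner_powr:
  fixes y :: "real^'n::finite"
  assumes "y \<noteq> 0"
  shows "((\<lambda>y. (y \<bullet> y) powr a) has_derivative (\<lambda>h. 2 * a * (y \<bullet> y) powr (a - 1) * (y \<bullet> h))) (at y)"
  using assms
  by (auto intro!: derivative_eq_intros simp: inner_commute powr_diff)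

lemma pd_inner_powr:
  fixes y :: "real^'n::finite"
  assumes "y \<noteq> 0"
  shows "pd i (\<lambda>y. (y \<bullet> y) powr a) y = 2 * a * (y \<bullet> y) powr (a - 1) * y $ i"
  using pd_eqI[OF has_derivative_inner_powr[OF assms], of i] by (simp add: inner_axis)

lemma pd_component: "pd i (\<lambda>y::real^'n::finite. y $ j) y = (if i = j then 1 else 0)"
  using pd_eqI[OF bounded_linear.has_derivative[OF bounded_linear_vec_nth has_derivative_ident], where x = y and i = i]
  by (simp add: axis_def)

lemma differentiable_component: "(\<lambda>y::real^'n::finite. y $ j) differentiable (at y)"
  using bounded_linear.has_derivative[OF bounded_linear_vec_nth has_derivative_ident]
  unfolding differentiable_def by blast

lemma differentiable_inner_powr:
  fixes y :: "real^'n::finite"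
  shows "y \<noteq> 0 \<Longrightarrow> (\<lambda>y. (y \<bullet> y) powr a) differentiable (at y)"
  using has_derivative_inner_powr unfolding differentiable_def by blast

definition kelvin :: "real \<Rightarrow> (real^'n::finite \<Rightarrow> real) \<Rightarrow> real^'n \<Rightarrow> real" where
  "kelvin \<rho> f y = (\<rho> / norm y) powr (real CARD('n) - 2) * f ((\<rho>\<^sup>2 / (norm y)\<^sup>2) *\<^sub>R y)"

text \<open>Powers of \<open>y \<bullet> y\<close> are easier to differentiate than powers of the
  norm. At \<open>y = 0\<close> both sides are 0, because \<open>0 powr\<close> is 0.\<close>

lemma kelvin_inner:
  fixes y :: "real^'n::finite"
  assumes "\<rho> > 0"
  shows "kelvin \<rho> f y = \<rho> powr (real CARD('n) - 2) *
     ((y \<bullet> y) powr (1 - real CARD('n) / 2) * f ((\<rho>\<^sup>2 / (y \<bullet> y)) *\<^sub>R y))"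
proof (cases "y = 0")
  case False
  have "(y \<bullet> y) powr (1 - real CARD('n) / 2) = norm y powr (2 * (1 - real CARD('n) / 2))"
    using False by (simp add: power2_norm_eq_inner[symmetric] powr_powr flip: powr_numeral)
  also have "\<dots> = 1 / norm y powr (real CARD('n) - 2)"
    by (simp add: powr_minus_divide[symmetric] algebra_simps)
  finally show ?thesis
    using assms by (simp add: kelvin_def powr_divide power2_norm_eq_inner)
qed (simp add: kelvin_def)

section \<open>Second derivatives of the Kelvin transform\<close>

lemma kelvin_core_pd:
  fixes y :: "real^'n::finite" and a k :: real and f :: "real^'n \<Rightarrow> real"
  defines "s \<equiv> \<lambda>y::real^'n. y \<bullet> y" and "T \<equiv> \<lambda>y::real^'n. (k / (y \<bullet> y)) *\<^sub>R y"
  assumes "y \<noteq> 0" "f differentiable (at (T y))"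
  shows "pd i (\<lambda>y. s y powr a * f (T y)) y =
     2 * a * (s y powr (a - 1) * (y $ i * f (T y))) + k * (s y powr (a - 1) * pd i f (T y))
     - 2 * k * (s y powr (a - 2) * (y $ i * (\<Sum>j\<in>UNIV. y $ j * pd j f (T y))))"
proof -
  \<comment> \<open>All powers are reduced to the lowest one, so that the remaining goal is
    polynomial with \<open>s y powr (a - 2)\<close> as an atom.\<close>
  have 1: "s y powr (a - 1) = s y powr (a - 2) * s y" "s y powr a = s y powr (a - 2) * (s y)\<^sup>2" and s: "s y > 0"
    using assms(3) by (auto simp: s_def powr_diff field_simps power2_eq_square)
  show ?thesis
    using assms(3,4)
    apply (subst pd_mult)
    apply (simp_all add: s_def T_def differentiable_inner_powr differentiable_compose_inversion pd_inner_powr pd_compose_inversion)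
    apply (simp add: 1[unfolded s_def])
    using s apply (simp add: s_def field_simps power2_eq_square)
    done
qed

text \<open>The algebra of the second partial with scalars for all analytic terms: \<open>P\<close>
  is \<open>s y powr (a - 3)\<close>, \<open>S\<close> is \<open>s y\<close>, \<open>t\<close> is
  \<open>y $ i\<close>, and \<open>F\<close>, \<open>u\<close>, \<open>u2\<close> are
  \<open>f\<close> and its first two partials in direction \<open>i\<close> at the inverted point.
  \<open>D\<close>, \<open>G\<close>, \<open>E\<close>, \<open>Q\<close> are the sums over
  \<open>j\<close>.\<close>

lemma kelvin_pd2_identity:
  fixes S :: real
  assumes "S > 0"
  shows "2 * a * (P * S\<^sup>2 * (t * (k / S * u - 2 * k * t / S\<^sup>2 * D) + 1 * F) + 2 * (a - 1) * (P * S) * t * (t * F)) +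
    k * (P * S\<^sup>2 * (k / S * u2 - 2 * k * t / S\<^sup>2 * G) + 2 * (a - 1) * (P * S) * t * u) +
    (- 2 * k) * (P * S * (t * (u + k / S * E - 2 * k * t / S\<^sup>2 * Q) + 1 * D) + 2 * (a - 2) * P * t * (t * D))
  = P * (2 * a * (2 * (a - 1) * S * t\<^sup>2 * F + S\<^sup>2 * F + k * S * t * u - 2 * k * t\<^sup>2 * D)
      + k * (2 * (a - 1) * S * t * u + k * S * u2 - 2 * k * (t * G))
      - 2 * k * (2 * (a - 2) * t\<^sup>2 * D + S * D + S * t * u + k * (t * E) - 2 * k * (t\<^sup>2 / S) * Q))"
proof -
  \<comment> \<open>With \<open>I\<close> constrained by \<open>S * I = 1\<close> the identity
    contains no division and becomes an ideal membership problem.\<close>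
  define I where "I = 1 / S"
  have "S * I = 1" using assms by (simp add: I_def)
  have d: "x / S = x * I" "x / S\<^sup>2 = x * I * I" for x
    by (simp_all add: I_def power2_eq_square)
  show ?thesis
    unfolding d using \<open>S * I = 1\<close> by algebra
qed

lemma kelvin_core_pd2:
  fixes y :: "real^'n::finite" and a k :: real and f :: "real^'n \<Rightarrow> real"
  defines "s \<equiv> \<lambda>y::real^'n. y \<bullet> y" and "T \<equiv> \<lambda>y::real^'n. (k / (y \<bullet> y)) *\<^sub>R y"
  defines "A \<equiv> \<lambda>i y. 2 * a * (s y powr (a - 1) * (y $ i * f (T y))) + k * (s y powr (a - 1) * pd i f (T y))
     - 2 * k * (s y powr (a - 2) * (y $ i * (\<Sum>j\<in>UNIV. y $ j * pd j f (T y))))"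
  assumes "y \<noteq> 0" "f differentiable (at (T y))" "\<And>i. pd i f differentiable (at (T y))"
  shows "A i differentiable (at y)"
   and "pd i (A i) y = s y powr (a - 3) * (
      2 * a * (2 * (a - 1) * s y * (y $ i)\<^sup>2 * f (T y) + (s y)\<^sup>2 * f (T y)
          + k * s y * y $ i * pd i f (T y) - 2 * k * (y $ i)\<^sup>2 * (\<Sum>j\<in>UNIV. y $ j * pd j f (T y)))
      + k * (2 * (a - 1) * s y * y $ i * pd i f (T y) + k * s y * pd i (pd i f) (T y)
          - 2 * k * (y $ i * (\<Sum>j\<in>UNIV. y $ j * pd j (pd i f) (T y))))
      - 2 * k * (2 * (a - 2) * (y $ i)\<^sup>2 * (\<Sum>j\<in>UNIV. y $ j * pd j f (T y))
          + s y * (\<Sum>j\<in>UNIV. y $ j * pd j f (T y))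
          + s y * y $ i * pd i f (T y)
          + k * (y $ i * (\<Sum>j\<in>UNIV. y $ j * pd i (pd j f) (T y)))
          - 2 * k * ((y $ i)\<^sup>2 / s y) * (\<Sum>j\<in>UNIV. y $ j * (\<Sum>l\<in>UNIV. y $ l * pd l (pd j f) (T y)))))"
proof -
  have 1: "s y powr (a - 2) = s y powr (a - 3) * s y" "s y powr (a - 1) = s y powr (a - 3) * (s y)\<^sup>2" and s: "s y > 0"
    using assms(4) by (auto simp: s_def powr_diff field_simps power2_eq_square eval_nat_numeral)
  have 2: "a - 1 - 1 = a - 2" "a - 2 - 1 = a - 3" by auto
  have dT: "(\<lambda>y. g (T y)) differentiable (at y)" if "g differentiable (at (T y))" for g
    using differentiable_compose_inversion[OF assms(4)] that by (simp add: T_def)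
  have ds: "(\<lambda>y. s y powr b) differentiable (at y)" for b
    using differentiable_inner_powr[OF assms(4)] by (simp add: s_def)
  note d = ds dT[OF assms(5)] dT[OF assms(6)] differentiable_component differentiable_const
  note di = ballI d differentiable_mult differentiable_sum differentiable_add differentiable_diff
  show "A i differentiable (at y)"
    unfolding A_def by (intro di) auto
  have pT: "pd i (\<lambda>y. g (T y)) y = k / s y * pd i g (T y)
     - 2 * k * y $ i / (s y)\<^sup>2 * (\<Sum>j\<in>UNIV. y $ j * pd j g (T y))" if "g differentiable (at (T y))" for g
    using pd_compose_inversion[OF assms(4)] that by (simp add: T_def s_def)
  have ps: "pd i (\<lambda>y. s y powr b) y = 2 * b * s y powr (b - 1) * y $ i" for b
    using pd_inner_powr[OF assms(4)] by (simp add: s_def)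
  note p = ps pT[OF assms(5)] pT[OF assms(6)] pd_component
  define D where "D = (\<Sum>j\<in>UNIV. y $ j * pd j f (T y))"
  have pdS: "pd i (\<lambda>y. \<Sum>j\<in>UNIV. y $ j * pd j f (T y)) y =
     pd i f (T y) + k / s y * (\<Sum>j\<in>UNIV. y $ j * pd i (pd j f) (T y)) -
        2 * k * y $ i / (s y)\<^sup>2 * (\<Sum>j\<in>UNIV. y $ j * (\<Sum>l\<in>UNIV. y $ l * pd l (pd j f) (T y)))"
    apply (subst pd_sum)
      apply simp
     apply (intro di)
    apply (subst pd_mult)
      apply (intro di)
     apply (intro di)
    apply (simp add: p sum.distrib sum_distrib_left right_diff_distrib sum_subtractf s_def mult_ac cong: if_cong)
    apply (simp add: if_distrib[of "\<lambda>x. _ * x"] sum_divide_distrib cong: if_cong)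
    done
  have split: "A i = (\<lambda>y. (2 * a * (s y powr (a - 1) * (y $ i * f (T y))) + k * (s y powr (a - 1) * pd i f (T y)))
     + (- 2 * k) * (s y powr (a - 2) * (y $ i * (\<Sum>j\<in>UNIV. y $ j * pd j f (T y)))))"
    by (simp add: A_def fun_eq_iff)
  have "pd i (A i) y = 2 * a * (s y powr (a - 1) * (y $ i * pd i (\<lambda>y. f (T y)) y + 1 * f (T y)) +
          2 * (a - 1) * s y powr (a - 2) * y $ i * (y $ i * f (T y))) +
     k * (s y powr (a - 1) * pd i (\<lambda>y. pd i f (T y)) y + 2 * (a - 1) * s y powr (a - 2) * y $ i * pd i f (T y)) +
     (- 2 * k) * (s y powr (a - 2) * (y $ i * pd i (\<lambda>y. \<Sum>j\<in>UNIV. y $ j * pd j f (T y)) y + 1 * D) +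
          2 * (a - 2) * s y powr (a - 3) * y $ i * (y $ i * D))"
    unfolding split D_def
    apply (subst pd_add, (intro di; simp)+)
    apply (subst pd_add, (intro di; simp)+)
    apply (subst pd_cmult, (intro di; simp)+)+
    apply (subst pd_mult, (intro di; simp)+)+
    apply (simp add: p(1,4) 2)
    done
  then show "pd i (A i) y = s y powr (a - 3) * (
      2 * a * (2 * (a - 1) * s y * (y $ i)\<^sup>2 * f (T y) + (s y)\<^sup>2 * f (T y)
          + k * s y * y $ i * pd i f (T y) - 2 * k * (y $ i)\<^sup>2 * (\<Sum>j\<in>UNIV. y $ j * pd j f (T y)))
      + k * (2 * (a - 1) * s y * y $ i * pd i f (T y) + k * s y * pd i (pd i f) (T y)
          - 2 * k * (y $ i * (\<Sum>j\<in>UNIV. y $ j * pd j (pd i f) (T y))))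
      - 2 * k * (2 * (a - 2) * (y $ i)\<^sup>2 * (\<Sum>j\<in>UNIV. y $ j * pd j f (T y))
          + s y * (\<Sum>j\<in>UNIV. y $ j * pd j f (T y))
          + s y * y $ i * pd i f (T y)
          + k * (y $ i * (\<Sum>j\<in>UNIV. y $ j * pd i (pd j f) (T y)))
          - 2 * k * ((y $ i)\<^sup>2 / s y) * (\<Sum>j\<in>UNIV. y $ j * (\<Sum>l\<in>UNIV. y $ l * pd l (pd j f) (T y)))))"
    unfolding p(2,3) pdS 1 D_def[symmetric]
    by (rule HOL.trans[OF _ kelvin_pd2_identity[OF s]])
qed


text \<open>The exponent comes from the summed second partials: the coefficient of \<open>f\<close>
  is a multiple of \<open>2 * (a - 1) + n\<close> and that of the radial derivative a multiple of
  \<open>4 - 4 * a - 2 * n\<close>. Both vanish at \<open>a = 1 - n / 2\<close>, while the second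
  radial derivatives cancel for every \<open>a\<close>. Only the Laplacian survives.\<close>

lemma kelvin_core_lap:
  fixes y :: "real^'n::finite" and k :: real and f :: "real^'n \<Rightarrow> real"
  defines "s \<equiv> \<lambda>y::real^'n. y \<bullet> y" and "T \<equiv> \<lambda>y::real^'n. (k / (y \<bullet> y)) *\<^sub>R y"
    and "a \<equiv> 1 - real CARD('n) / 2"
  assumes S: "open S" "twice_diff S f" and S': "open S'" "\<forall>y\<in>S'. y \<noteq> 0 \<and> T y \<in> S"
  shows "twice_diff S' (\<lambda>y. s y powr a * f (T y))"
    and "y \<in> S' \<Longrightarrow> lap (\<lambda>y. s y powr a * f (T y)) y = k\<^sup>2 * s y powr (a - 2) * lap f (T y)"
proof -
  note f = twice_diffD[OF S(2)]
  define A where "A = (\<lambda>i y. 2 * a * (s y powr (a - 1) * (y $ i * f (T y))) + k * (s y powr (a - 1) * pd i f (T y))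
     - 2 * k * (s y powr (a - 2) * (y $ i * (\<Sum>j\<in>UNIV. y $ j * pd j f (T y)))))"
  have pd: "pd i (\<lambda>y. s y powr a * f (T y)) y = A i y" if "y \<in> S'" for i y
    using kelvin_core_pd[where y = y and f = f and k = k and a = a and i = i] f(1) bspec[OF S'(2) that] by (simp add: A_def s_def T_def)
  have dA: "A i differentiable (at y)" if "y \<in> S'" for i y
    using kelvin_core_pd2(1)[where y = y and f = f and k = k and a = a and i = i] f bspec[OF S'(2) that] by (simp add: A_def s_def T_def)
  have "(\<lambda>y. s y powr a * f (T y)) differentiable (at y)" if "y \<in> S'" for y
    using bspec[OF S'(2) that] f unfolding s_def T_def
    by (intro differentiable_mult differentiable_inner_powr differentiable_compose_inversion) auto
  moreover have "pd i (\<lambda>y. s y powr a * f (T y)) differentiable (at y)" if "y \<in> S'" for i y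
    by (rule differentiable_cong[OF S'(1) that pd[symmetric] dA[OF that]])
  ultimately show "twice_diff S' (\<lambda>y. s y powr a * f (T y))"
    by (auto simp: twice_diff_def)
  show "lap (\<lambda>y. s y powr a * f (T y)) y = k\<^sup>2 * s y powr (a - 2) * lap f (T y)" if y: "y \<in> S'"
  proof -
    define F D L Q where "F = f (T y)" and "D = (\<Sum>j\<in>UNIV. y $ j * pd j f (T y))" and "L = lap f (T y)"
      and "Q = (\<Sum>j\<in>UNIV. y $ j * (\<Sum>l\<in>UNIV. y $ l * pd l (pd j f) (T y)))"
    have s: "s y > 0"
      using bspec[OF S'(2) y] by (simp add: s_def)
    have sq: "(\<Sum>i\<in>UNIV. (y $ i)\<^sup>2) = s y"
      by (simp add: s_def inner_vec_def power2_eq_square)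
    \<comment> \<open>Weighted by \<open>y $ i * y $ j\<close> and summed, the two orders of the
      mixed partials agree by exchanging the sums; their symmetry is not invoked.\<close>
    have Q': "(\<Sum>i\<in>UNIV. y $ i * (\<Sum>j\<in>UNIV. y $ j * pd i (pd j f) (T y))) = Q"
      unfolding Q_def sum_distrib_left by (subst sum.swap) (simp add: mult_ac)
    have L: "(\<Sum>i\<in>UNIV. pd i (pd i f) (T y)) = L"
      by (simp add: L_def lap_def)
    define P where "P i = 2 * a * (2 * (a - 1) * s y * (y $ i)\<^sup>2 * F + (s y)\<^sup>2 * F
          + k * s y * y $ i * pd i f (T y) - 2 * k * (y $ i)\<^sup>2 * D)
      + k * (2 * (a - 1) * s y * y $ i * pd i f (T y) + k * s y * pd i (pd i f) (T y)
          - 2 * k * (y $ i * (\<Sum>j\<in>UNIV. y $ j * pd j (pd i f) (T y))))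
      - 2 * k * (2 * (a - 2) * (y $ i)\<^sup>2 * D
          + s y * D
          + s y * y $ i * pd i f (T y)
          + k * (y $ i * (\<Sum>j\<in>UNIV. y $ j * pd i (pd j f) (T y)))
          - 2 * k * ((y $ i)\<^sup>2 / s y) * Q)" for i
    have "pd i (pd i (\<lambda>y. s y powr a * f (T y))) y = s y powr (a - 3) * P i" for i
    proof -
      have "pd i (pd i (\<lambda>y. s y powr a * f (T y))) y = pd i (A i) y"
        by (rule pd_cong[OF S'(1) y pd])
      also have "\<dots> = s y powr (a - 3) * P i"
        using kelvin_core_pd2(2)[where y = y and f = f and k = k and a = a and i = i] f bspec[OF S'(2) y]
        unfolding A_def s_def T_def P_def F_def D_def Q_def by simp
      finally show ?thesis .
    qed
    then have "lap (\<lambda>y. s y powr a * f (T y)) y = s y powr (a - 3) * (\<Sum>i\<in>UNIV. P i)"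
      by (simp add: lap_def sum_distrib_left)
    also have "(\<Sum>i\<in>UNIV. P i) = k\<^sup>2 * s y * L"
    proof -
      have Pi: "P i = (2 * a * (2 * (a - 1) * s y * F - 2 * k * D) - 2 * k * (2 * (a - 2) * D - 2 * k * Q / s y)) * (y $ i)\<^sup>2
          + (2 * a * k * s y + 2 * k * (a - 1) * s y - 2 * k * s y) * (y $ i * pd i f (T y))
          + k * k * s y * pd i (pd i f) (T y)
          + (- 2 * k * k) * (y $ i * (\<Sum>j\<in>UNIV. y $ j * pd j (pd i f) (T y)))
          + (- 2 * k * k) * (y $ i * (\<Sum>j\<in>UNIV. y $ j * pd i (pd j f) (T y)))
          + (2 * a * (s y)\<^sup>2 * F - 2 * k * s y * D)" for i
        unfolding P_def by (simp add: algebra_simps power2_eq_square)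
      have "(\<Sum>i\<in>UNIV. P i) = (2 * a * (2 * (a - 1) * s y * F - 2 * k * D) - 2 * k * (2 * (a - 2) * D - 2 * k * Q / s y)) * s y
          + (2 * a * k * s y + 2 * k * (a - 1) * s y - 2 * k * s y) * D
          + k * k * s y * L + (- 2 * k * k) * Q + (- 2 * k * k) * Q
          + real CARD('n) * (2 * a * (s y)\<^sup>2 * F - 2 * k * s y * D)"
        unfolding Pi sum.distrib sum_distrib_left[symmetric]
        by (simp only: sq L Q' D_def[symmetric] Q_def[symmetric] sum_constant of_nat_id)
      then show ?thesis
        using s by (simp add: a_def field_simps power2_eq_square)
    qed
    also have "s y powr (a - 3) * (k\<^sup>2 * s y * L) = k\<^sup>2 * s y powr (a - 2) * L"
      using s by (simp add: powr_diff eval_nat_numeral field_simps)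
    finally show ?thesis
      by (simp add: L_def)
  qed
qed

lemma twice_diff_lap_kelvin:
  fixes y :: "real^'n::finite"
  assumes "\<rho> > 0" "open S" "twice_diff S f"
    and S': "open S'" "\<And>y. y \<in> S' \<Longrightarrow> y \<noteq> 0 \<and> (\<rho>\<^sup>2 / (norm y)\<^sup>2) *\<^sub>R y \<in> S"
  shows "twice_diff S' (kelvin \<rho> f)"
    and "y \<in> S' \<Longrightarrow> lap (kelvin \<rho> f) y
       = (\<rho> / norm y) powr (real CARD('n) + 2) * lap f ((\<rho>\<^sup>2 / (norm y)\<^sup>2) *\<^sub>R y)"
proof -
  have eq: "kelvin \<rho> f = (\<lambda>y. \<rho> powr (real CARD('n) - 2) *
     ((y \<bullet> y) powr (1 - real CARD('n) / 2) * f ((\<rho>\<^sup>2 / (y \<bullet> y)) *\<^sub>R y)))"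
    by (rule ext) (rule kelvin_inner[OF assms(1)])
  have "\<forall>y\<in>S'. y \<noteq> 0 \<and> (\<rho>\<^sup>2 / (y \<bullet> y)) *\<^sub>R y \<in> S"
    using S'(2) by (simp add: power2_norm_eq_inner)
  note core = kelvin_core_lap[OF assms(2,3) S'(1) this]
  show "twice_diff S' (kelvin \<rho> f)"
    unfolding eq using core(1) by (rule twice_diff_lap_cmult(1)[OF S'(1)])
  show "lap (kelvin \<rho> f) y
       = (\<rho> / norm y) powr (real CARD('n) + 2) * lap f ((\<rho>\<^sup>2 / (norm y)\<^sup>2) *\<^sub>R y)" if "y \<in> S'"
  proof -
    have y: "norm y > 0"
      using S'(2) that by auto
    \<comment> \<open>Here \<open>k\<close> is \<open>\<rho>\<^sup>2\<close>, so the factor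
      \<open>k\<^sup>2\<close> raises the exponent \<open>n - 2\<close> by 4.\<close>
    have 1: "(\<rho>\<^sup>2)\<^sup>2 * \<rho> powr (real CARD('n) - 2) = \<rho> powr (real CARD('n) + 2)"
      using assms(1) by (simp add: powr_add powr_diff eval_nat_numeral)
    have "(y \<bullet> y) powr (1 - real CARD('n) / 2 - 2) = norm y powr (2 * (1 - real CARD('n) / 2 - 2))"
      using y by (simp add: power2_norm_eq_inner[symmetric] powr_powr flip: powr_numeral)
    also have "2 * (1 - real CARD('n) / 2 - 2) = - (real CARD('n) + 2)"
      by simp
    also have "norm y powr - (real CARD('n) + 2) = 1 / norm y powr (real CARD('n) + 2)"
      by (rule powr_minus_divide)
    finally show ?thesis
      unfolding eq using twice_diff_lap_cmult(2)[OF S'(1) core(1) that] core(2)[OF that] assms(1) y 1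
      by (simp add: powr_divide power2_norm_eq_inner[symmetric] mult_ac)
  qed
qed

text \<open>The fundamental solution of the Laplacian with pole \<open>a\<close>, up to a constant
  factor. At the pole its value is 0 by the convention for \<open>powr\<close>, not
  infinity.\<close>

definition fund :: "real^'n::finite \<Rightarrow> real^'n \<Rightarrow> real" where
  "fund a y = norm (y - a) powr (2 - real CARD('n))"

text \<open>\<open>fund a\<close> is a translate of the Kelvin transform of the constant 1, so its
  harmonicity is an instance of the computation above.\<close>

lemma twice_diff_lap_fund:
  fixes a :: "real^'n::finite"
  assumes "open S" "a \<notin> S"
  shows "twice_diff S (fund a)" and "y \<in> S \<Longrightarrow> lap (fund a) y = 0"
proof -
  have eq0: "norm y powr (2 - real CARD('n)) = kelvin 1 (\<lambda>y. 1) y" for y :: "real^'n"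
    by (simp add: kelvin_def powr_divide powr_minus_divide[symmetric])
  have eq: "fund a = (\<lambda>y. kelvin 1 (\<lambda>y. 1) (y + (- a)))"
    by (simp add: fun_eq_iff fund_def eq0)
  have k: "twice_diff (- {0}) (kelvin 1 (\<lambda>y. 1) :: real^'n \<Rightarrow> real)"
    by (rule twice_diff_lap_kelvin(1)[OF _ open_UNIV twice_diff_const]) auto
  have t: "twice_diff (- {a}) (fund a)"
    unfolding eq by (rule twice_diff_lap_shift(1)[OF _ k]) auto
  show "twice_diff S (fund a)"
    using twice_diff_subset[OF t] assms by blast
  show "lap (fund a) y = 0" if "y \<in> S"
  proof -
    have "y + (- a) \<in> - {0}"
      using that assms by auto
    then show ?thesis
      unfolding eq using twice_diff_lap_shift(2)[OF _ k, of "- {a}" "- a" y]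
        twice_diff_lap_kelvin(2)[OF _ open_UNIV twice_diff_const, of 1 "- {0}" "y + (- a)" 1]
      by (auto simp: lap_const)
  qed
qed

subsection \<open>Maximum principles for superharmonic functions\<close>

text \<open>If the second partial were negative, the first partial, which vanishes at the minimum,
  would be negative just beyond it; the mean value theorem would then produce a smaller value. No
  continuity of the second partial enters.\<close>

lemma pd_pd_nonneg_at_local_min:
  fixes f :: "real^'n::finite \<Rightarrow> real"
  assumes "open S" "twice_diff S f" "x \<in> S" "\<And>y. y \<in> S \<Longrightarrow> f x \<le> f y"
  shows "pd i (pd i f) x \<ge> 0"
proof (rule ccontr)
  assume neg: "\<not> pd i (pd i f) x \<ge> 0"
  define e :: "real^'n" where "e = axis i 1"
  have ne: "norm (t *\<^sub>R e) = \<bar>t\<bar>" for t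
    by (simp add: e_def norm_axis_1)
  obtain d where d: "d > 0" "ball x d \<subseteq> S"
    using assms(1,3) openE by blast
  have inS: "x + t *\<^sub>R e \<in> S" if "\<bar>t\<bar> < d" for t
    using subsetD[OF d(2), of "x + t *\<^sub>R e"] that ne[of t] by (simp add: dist_norm del: norm_scaleR)
  have der: "((\<lambda>t. g (x + t *\<^sub>R e)) has_real_derivative pd i g (x + t *\<^sub>R e)) (at t)"
    if "g differentiable (at (x + t *\<^sub>R e))" for g t
  proof -
    have "((\<lambda>t. x + t *\<^sub>R e) has_derivative (\<lambda>h. h *\<^sub>R e)) (at t)"
      by (auto intro!: derivative_eq_intros)
    from has_derivative_compose[OF this has_derivative_pd[OF that]]
    have "((\<lambda>t. g (x + t *\<^sub>R e)) has_derivative (\<lambda>h. pd i g (x + t *\<^sub>R e) * h)) (at t)"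
      by (simp add: e_def axis_def if_distrib[of "\<lambda>x. _ * x"] if_distrib[of "\<lambda>x. x * _"] mult.commute cong: if_cong)
    then show ?thesis
      by (simp add: has_field_derivative_def)
  qed
  have d1: "((\<lambda>t. f (x + t *\<^sub>R e)) has_real_derivative pd i f (x + t *\<^sub>R e)) (at t)" if "\<bar>t\<bar> < d" for t
    by (rule der) (use inS[OF that] twice_diffD(1)[OF assms(2)] in blast)
  have "((\<lambda>t. pd i f (x + t *\<^sub>R e)) has_real_derivative pd i (pd i f) (x + 0 *\<^sub>R e)) (at 0)"
    by (rule der) (use inS[of 0] d(1) twice_diffD(2)[OF assms(2)] in auto)
  then have d2: "((\<lambda>t. pd i f (x + t *\<^sub>R e)) has_real_derivative pd i (pd i f) x) (at 0)"
    by simp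
  have zero: "pd i f (x + 0 *\<^sub>R e) = 0"
    by (rule DERIV_local_min[OF d1[of 0] d(1)]) (use inS assms(4) d(1) in auto)
  obtain b where b: "b > 0" "\<And>h. 0 < h \<Longrightarrow> h < b \<Longrightarrow> pd i f (x + (0 + h) *\<^sub>R e) < pd i f (x + 0 *\<^sub>R e)"
    using DERIV_neg_dec_right[OF d2] neg by auto
  define h where "h = min b d / 2"
  have h: "0 < h" "h < b" "h < d"
    using b(1) d(1) by (auto simp: h_def)
  obtain z where z: "0 < z" "z < h" "f (x + h *\<^sub>R e) - f (x + 0 *\<^sub>R e) = (h - 0) * pd i f (x + z *\<^sub>R e)"
    using MVT2[OF h(1), of "\<lambda>t. f (x + t *\<^sub>R e)" "\<lambda>t. pd i f (x + t *\<^sub>R e)"] d1 h by force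
  have "pd i f (x + z *\<^sub>R e) < 0"
    using b(2)[of z] z h zero by simp
  then have "f (x + h *\<^sub>R e) < f x"
    using z(3) h(1) mult_pos_neg[of h "pd i f (x + z *\<^sub>R e)"] by simp
  then show False
    using assms(4) inS[of h] h by force
qed

text \<open>Compactness of the sets \<open>{y \<in> S. w y \<le> - e}\<close> replaces boundary
  values: it says that the negative part of \<open>w\<close> reaches neither the boundary nor
  infinity. This form covers unbounded and punctured domains alike.\<close>

lemma min_principle:
  fixes w :: "real^'n::finite \<Rightarrow> real"
  assumes S: "open S" "twice_diff S w" and lap: "\<And>y. y \<in> S \<Longrightarrow> lap w y \<le> 0"
    and cpt: "\<And>e. e > 0 \<Longrightarrow> compact {y \<in> S. w y \<le> - e}"
    and y: "y \<in> S"
  shows "w y \<ge> 0"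
proof (rule ccontr)
  assume "\<not> w y \<ge> 0"
  define e where "e = - w y / 2"
  have e: "e > 0" "w y = - 2 * e"
    using \<open>\<not> w y \<ge> 0\<close> by (auto simp: e_def)
  define K where "K = {y \<in> S. w y \<le> - e}"
  have K: "compact K" "y \<in> K" "K \<subseteq> S"
    using cpt[OF e(1)] y e by (auto simp: K_def)
  obtain M where M: "M > 0" "\<And>z. z \<in> K \<Longrightarrow> norm z \<le> M"
    using compact_imp_bounded[OF K(1)] bounded_pos by blast
  text \<open>A small multiple of the square of the norm makes the Laplacian strictly negative.\<close>
  define \<delta> where "\<delta> = e / (2 * M\<^sup>2)"
  have \<delta>: "\<delta> > 0" "\<delta> * M\<^sup>2 < e"
    using e M by (auto simp: \<delta>_def field_simps)
  define v where "v = (\<lambda>z. w z + (- \<delta>) * (z \<bullet> z))"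
  have td: "twice_diff S (\<lambda>z. - \<delta> * (z \<bullet> z))"
    by (rule twice_diff_lap_cmult(1)[OF S(1) twice_diff_lap_inner(1)])
  have v: "twice_diff S v"
    unfolding v_def by (rule twice_diff_lap_add(1)[OF S td])
  have lapv: "lap v z < 0" if "z \<in> S" for z
  proof -
    have "lap v z = lap w z + (- \<delta>) * (2 * real CARD('n))"
      unfolding v_def twice_diff_lap_add(2)[OF S td that]
        twice_diff_lap_cmult(2)[OF S(1) twice_diff_lap_inner(1) that] twice_diff_lap_inner(2) ..
    moreover have "\<delta> * (2 * real CARD('n)) > 0"
      using \<delta> by simp
    ultimately show ?thesis
      using lap[OF that] by simp
  qed
  have sq: "z \<bullet> z \<le> M\<^sup>2" if "z \<in> K" for z
    using M(2)[OF that] by (metis norm_ge_zero power2_norm_eq_inner power_mono)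
  have "continuous_on K v"
    using continuous_on_subset[OF twice_diff_continuous_on[OF v] K(3)] .
  then obtain x where x: "x \<in> K" "\<And>z. z \<in> K \<Longrightarrow> v x \<le> v z"
    using continuous_attains_inf[of K v] K by blast
  have vx: "v x \<le> - 2 * e"
    using x(2)[OF K(2)] e(2) mult_nonneg_nonneg[OF less_imp_le[OF \<delta>(1)] inner_ge_zero[of y]] by (simp add: v_def)
  moreover have "\<delta> * (x \<bullet> x) \<le> \<delta> * M\<^sup>2"
    using sq[OF x(1)] \<delta>(1) by simp
  ultimately have wx: "w x < - e"
    using \<delta>(2) unfolding v_def by linarith
  \<comment> \<open>Since \<open>w y = - 2 * e\<close> and the perturbation costs less than
    \<open>e\<close> on \<open>K\<close>, the minimiser satisfies \<open>w x < - e\<close> strictly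
    and hence has an open neighbourhood inside \<open>K\<close>.\<close>
  define O1 where "O1 = S \<inter> w -` {..< - e}"
  have "open O1"
    unfolding O1_def by (rule continuous_open_preimage[OF twice_diff_continuous_on[OF S(2)] S(1)]) auto
  moreover have "O1 \<subseteq> K" "O1 \<subseteq> S" "x \<in> O1"
    using x(1) K(3) wx by (auto simp: O1_def K_def)
  ultimately have "pd i (pd i v) x \<ge> 0" for i
    using pd_pd_nonneg_at_local_min[of O1 v x i] twice_diff_subset[OF v] x(2) by blast
  then have "lap v x \<ge> 0"
    by (simp add: lap_def sum_nonneg)
  then show False
    using lapv[of x] x(1) K(3) by force
qed

lemma min_principle_bounded:
  fixes w :: "real^'n::finite \<Rightarrow> real"
  assumes S: "open S" "bounded S" "twice_diff S w" and lap: "\<And>y. y \<in> S \<Longrightarrow> lap w y \<le> 0"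
    and K: "closed K" "bounded K" "S \<subseteq> K" "continuous_on K w" and bd: "\<And>y. y \<in> K - S \<Longrightarrow> w y \<ge> 0"
    and y: "y \<in> S"
  shows "w y \<ge> 0"
proof (rule min_principle[OF S(1,3) lap _ y])
  fix e :: real assume "e > 0"
  have "{y \<in> S. w y \<le> - e} = K \<inter> w -` {.. - e}"
    using K(3) bd \<open>e > 0\<close> by force
  moreover have "closed (K \<inter> w -` {.. - e})"
    by (rule continuous_closed_preimage[OF K(4,1)]) auto
  ultimately show "compact {y \<in> S. w y \<le> - e}"
    using K(2) by (metis bounded_Int compact_eq_bounded_closed)
qed

text \<open>Away from \<open>a\<close> the functions \<open>A + B * fund a\<close> are harmonic and
  constant on spheres about \<open>a\<close>. They are the barriers for the strong minimum principle
  and for the Hopf lemma.\<close>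

lemma annulus_comparison:
  fixes w :: "real^'n::finite \<Rightarrow> real"
  assumes r: "0 < r" 
    and S: "S = {y. r < norm (y - a) \<and> norm (y - a) < R}" and K: "K = {y. r \<le> norm (y - a) \<and> norm (y - a) \<le> R}"
    and w: "continuous_on K w" "twice_diff S w" "\<And>y. y \<in> S \<Longrightarrow> lap w y \<le> 0"
    and bd: "\<And>y. y \<in> K \<Longrightarrow> norm (y - a) = r \<or> norm (y - a) = R \<Longrightarrow> w y \<ge> A + B * fund a y"
    and y: "y \<in> K"
  shows "w y \<ge> A + B * fund a y"
proof (cases "y \<in> S")
  case True
  have "open S"
    unfolding S by (intro open_Collect_conj open_Collect_less continuous_intros)
  have "closed K"
    unfolding K by (intro closed_Collect_conj closed_Collect_le continuous_intros)
  have K': "bounded K"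
    by (rule bounded_subset[of "cball a R"]) (auto simp: K dist_norm norm_minus_commute)
  have SK: "S \<subseteq> K"
    by (auto simp: S K)
  have "a \<notin> S" "a \<notin> K"
    using r by (auto simp: S K)
  note f = twice_diff_lap_fund[OF \<open>open S\<close> \<open>a \<notin> S\<close>]
  note cf = twice_diff_lap_cmult[OF \<open>open S\<close> f(1), where c = B]
  note acf = twice_diff_lap_add[OF \<open>open S\<close> twice_diff_const[where c = A] cf(1)]
  note all = twice_diff_lap_diff[OF \<open>open S\<close> w(2) acf(1)]
  have "w y - (A + B * fund a y) \<ge> 0"
  proof (rule min_principle_bounded[OF \<open>open S\<close> bounded_subset[OF K' SK] all(1) _ \<open>closed K\<close> K' SK _ _ True])
    fix z assume "z \<in> S"
    then show "lap (\<lambda>y. w y - (A + B * fund a y)) z \<le> 0"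
      using w(3) by (simp add: all(2) acf(2) cf(2) f(2) lap_const)
  next
    show "continuous_on K (\<lambda>y. w y - (A + B * fund a y))"
      unfolding fund_def using \<open>a \<notin> K\<close> by (intro continuous_intros w(1)) auto
  next
    fix z assume "z \<in> K - S"
    then show "w z - (A + B * fund a z) \<ge> 0"
      using bd[of z] by (force simp: S K)
  qed
  then show ?thesis by simp
next
  case False
  then show ?thesis
    using y bd[of y] by (force simp: S K)
qed

section \<open>Strong minimum principle and lower bounds in exterior domains\<close>

lemma powr_dim_less:
  assumes "CARD('n::finite) \<ge> 3" "0 < r" "r < s"
  shows "s powr (2 - real CARD('n)) < r powr (2 - real CARD('n))"
  using assms by (intro powr_less_mono2_neg) auto

text \<open>Continuity gives a positive lower bound on a small ball about \<open>a\<close>; a radial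
  barrier carries it out to every radius below \<open>R\<close>.\<close>

lemma positive_on_ball:
  fixes w :: "real^'n::finite \<Rightarrow> real"
  assumes n: "CARD('n) \<ge> 3" and S: "open S" "twice_diff S w" and sup: "\<And>y. y \<in> S \<Longrightarrow> lap w y \<le> 0"
    and nonneg: "\<And>y. y \<in> S \<Longrightarrow> w y \<ge> 0"
    and a: "w a > 0" "cball a R \<subseteq> S" and y: "norm (y - a) < R"
  shows "w y > 0"
proof -
  have R: "R > 0"
    using y by (rule order.strict_trans1[OF norm_ge_zero])
  then have "a \<in> S"
    using a by auto
  have cont: "continuous_on S w"
    using twice_diff_continuous_on[OF S(2)] .
  then have "isCont w a"
    using \<open>a \<in> S\<close> S(1) continuous_on_eq_continuous_at by blast
  then have "\<forall>\<^sub>F z in nhds a. w z > w a / 2"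
    using order_tendstoD(1)[of w "w a" "nhds a" "w a / 2"] a(1) by (auto simp: isCont_def tendsto_at_iff_tendsto_nhds)
  then obtain d where d: "d > 0" "\<And>z. norm (z - a) < d \<Longrightarrow> w z > w a / 2"
    unfolding eventually_nhds_metric dist_norm by blast
  define r where "r = min d R / 2"
  have r: "0 < r" "r < d" "r < R"
    using d R by (auto simp: r_def)
  show ?thesis
  proof (cases "norm (y - a) \<le> r")
    case True
    then show ?thesis
      using d(2)[of y] r a(1) by auto
  next
    case False
    define D where "D = r powr (2 - real CARD('n)) - R powr (2 - real CARD('n))"
    have D: "D > 0"
      using powr_dim_less[OF n r(1,3)] by (simp add: D_def)
    \<comment> \<open>The coefficients make the barrier equal to \<open>w a / 2\<close> at radius
      \<open>r\<close> and to 0 at radius \<open>R\<close>.\<close>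
    define B A where "B = w a / 2 / D" and "A = - (B * R powr (2 - real CARD('n)))"
    have B: "B > 0"
      using D a(1) by (simp add: B_def)
    have ABr: "A + B * r powr (2 - real CARD('n)) = w a / 2"
    proof -
      have "A + B * r powr (2 - real CARD('n)) = B * D"
        by (simp add: A_def D_def algebra_simps)
      then show ?thesis
        using D by (simp add: B_def)
    qed
    have inS: "z \<in> S" if "norm (z - a) \<le> R" for z
      using a(2) that by (auto simp: subset_iff dist_norm norm_minus_commute)
    have "w y \<ge> A + B * fund a y"
    proof (rule annulus_comparison[OF r(1) refl refl, where R = R])
      show "continuous_on {y. r \<le> norm (y - a) \<and> norm (y - a) \<le> R} w"
        by (rule continuous_on_subset[OF cont]) (use inS in auto)
      show "twice_diff {y. r < norm (y - a) \<and> norm (y - a) < R} w"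
        by (rule twice_diff_subset[OF S(2)]) (use inS in auto)
      fix z assume "z \<in> {y. r < norm (y - a) \<and> norm (y - a) < R}"
      then show "lap w z \<le> 0"
        using sup[of z] inS[of z] by auto
    next
      fix z assume "z \<in> {y. r \<le> norm (y - a) \<and> norm (y - a) \<le> R}"
      then have z: "z \<in> S" using inS by auto
      assume "norm (z - a) = r \<or> norm (z - a) = R"
      then show "A + B * fund a z \<le> w z"
      proof
        assume "norm (z - a) = r"
        then show ?thesis
          using d(2)[of z] r(2) ABr by (simp add: fund_def)
      next
        assume "norm (z - a) = R"
        then show ?thesis
          using nonneg[OF z] by (simp add: fund_def A_def)
      qed
    qed (use False y in auto)
    moreover have "A + B * fund a y > 0"
    proof -
      have "R powr (2 - real CARD('n)) < norm (y - a) powr (2 - real CARD('n))"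
        by (rule powr_dim_less[OF n _ y]) (use r(1) False in linarith)
      then show ?thesis
        using B by (simp add: A_def fund_def)
    qed
    ultimately show ?thesis by simp
  qed
qed

text \<open>The zero set is open as well as the positivity set: a positive point \<open>b\<close>
  close to a zero \<open>z\<close> is the centre of a ball inside \<open>S\<close> that contains
  \<open>z\<close>, and \<open>w\<close> is positive on that ball. Halving the radius keeps this
  ball inside \<open>S\<close>.\<close>

lemma strong_min_principle:
  fixes w :: "real^'n::finite \<Rightarrow> real"
  assumes n: "CARD('n) \<ge> 3" and S: "open S" "connected S" "twice_diff S w"
    and sup: "\<And>y. y \<in> S \<Longrightarrow> lap w y \<le> 0" and nonneg: "\<And>y. y \<in> S \<Longrightarrow> w y \<ge> 0"
    and a: "a \<in> S" "w a > 0" and y: "y \<in> S"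
  shows "w y > 0"
proof (rule ccontr)
  assume "\<not> w y > 0"
  define P where "P = {z \<in> S. w z > 0}"
  define N where "N = {z \<in> S. w z = 0}"
  have cont: "continuous_on S w"
    using twice_diff_continuous_on[OF S(3)] .
  have "open P"
    using continuous_open_preimage[OF cont S(1), of "{0<..}"]
    by (simp add: P_def vimage_def Int_def)
  moreover have "open N"
    unfolding open_contains_ball
  proof
    fix z assume z: "z \<in> N"
    then obtain r where r: "r > 0" "ball z r \<subseteq> S"
      using S(1) openE[of S z] by (auto simp: N_def)
    have "w b = 0" if b: "b \<in> ball z (r / 2)" for b
    proof (rule ccontr)
      assume "w b \<noteq> 0"
      have "b \<in> S"
        using b r by (auto simp: subset_iff)
      then have "w b > 0"
        using \<open>w b \<noteq> 0\<close> nonneg[of b] by simp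
      moreover have "dist z c < r" if "dist b c \<le> r / 2" for c
        using dist_triangle[of z c b] b that by simp
      then have "cball b (r / 2) \<subseteq> S"
        using r(2) by (auto simp: subset_iff)
      ultimately have "w z > 0"
        using positive_on_ball[OF n S(1,3) sup nonneg, of b "r / 2" z] b by (simp add: dist_norm)
      then show False
        using z by (simp add: N_def)
    qed
    then have "ball z (r / 2) \<subseteq> N"
      using r by (auto simp: N_def subset_iff)
    then show "\<exists>e>0. ball z e \<subseteq> N"
      using r(1) by (intro exI[of _ "r / 2"]) auto
  qed
  moreover have "S \<subseteq> P \<union> N"
    using nonneg by (force simp: P_def N_def)
  moreover have "a \<in> P \<inter> S" "y \<in> N \<inter> S" "P \<inter> N \<inter> S = {}"
    using a y \<open>\<not> w y > 0\<close> nonneg[OF y] by (auto simp: P_def N_def)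
  ultimately show False
    using connectedD[OF S(2)] by blast
qed

text \<open>The comparison function \<open>c * fund 0\<close> is harmonic and tends to 0 at
  infinity, so nonnegativity of \<open>w\<close> suffices there. At the puncture
  \<open>\<eta> * fund z\<close> forces positivity, and afterwards \<eta> tends to 0.\<close>

lemma exterior_lower_bound:
  fixes w :: "real^'n::finite \<Rightarrow> real"
  assumes n: "CARD('n) \<ge> 3" and r: "0 < r" "r < r1" "r1 < norm z"
    and S: "S = {y. r < norm y} - {z}" "twice_diff S w" "\<And>y. y \<in> S \<Longrightarrow> lap w y \<le> 0"
    and nonneg: "\<And>y. y \<in> S \<Longrightarrow> w y \<ge> 0" and pos: "\<And>y. norm y = r1 \<Longrightarrow> w y > 0"
  shows "\<exists>c>0. \<forall>y. r1 \<le> norm y \<and> y \<noteq> z \<longrightarrow> c * norm y powr (2 - real CARD('n)) \<le> w y"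
proof -
  define m where "m = 2 - real CARD('n)"
  have m: "m < 0" using n by (simp add: m_def)
  have f0: "fund 0 y = norm y powr m" for y :: "real^'n"
    by (simp add: fund_def m_def)
  have contS: "continuous_on S w"
    using twice_diff_continuous_on[OF S(2)] .
  have sph: "sphere 0 r1 \<subseteq> S"
    using r by (auto simp: S(1))
  obtain k :: "real^'n" where "norm k = r1"
    using vector_choose_size[of r1] r by auto
  then have "sphere (0::real^'n) r1 \<noteq> {}"
    by (metis dist_0_norm empty_iff mem_sphere)
  then obtain b where b: "b \<in> sphere 0 r1" "\<And>y. y \<in> sphere 0 r1 \<Longrightarrow> w b \<le> w y"
    using continuous_attains_inf[OF compact_sphere _ continuous_on_subset[OF contS sph]] by blast
  \<comment> \<open>On the sphere of radius \<open>r1\<close> the comparison function then equals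
    the minimum of \<open>w\<close> there, and farther out it is no larger than that
    minimum.\<close>
  define c where "c = w b / r1 powr m"
  have wb: "w b > 0"
    using pos b(1) by simp
  then have c: "c > 0"
    using r by (simp add: c_def)
  define T where "T = {y. r1 < norm y} - {z}"
  have oT: "open T"
    unfolding T_def by (intro open_Diff open_Collect_less continuous_intros closed_singleton)
  have TS: "T \<subseteq> S"
    using r by (auto simp: T_def S(1))
  have "0 \<notin> T" "z \<notin> T"
    using r by (auto simp: T_def)
  note f = twice_diff_lap_fund[OF oT \<open>0 \<notin> T\<close>] twice_diff_lap_fund[OF oT \<open>z \<notin> T\<close>]
  note wT = twice_diff_subset[OF S(2) TS]
  have main: "w y - c * fund 0 y + \<eta> * fund z y \<ge> 0" if \<eta>: "\<eta> > 0" and yT: "y \<in> T" for \<eta> y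
  proof -
    note c0 = twice_diff_lap_cmult[OF oT f(1), where c = c]
    note c1 = twice_diff_lap_cmult[OF oT f(3), where c = \<eta>]
    note d = twice_diff_lap_diff[OF oT wT c0(1)]
    note all = twice_diff_lap_add[OF oT d(1) c1(1)]
    have fb: "c * fund 0 y \<le> w b" if "norm y \<ge> r1" for y :: "real^'n"
    proof -
      have "norm y powr m \<le> r1 powr m"
        using that r m by (intro powr_mono2') auto
      then have "c * norm y powr m \<le> c * r1 powr m"
        using c by (intro mult_left_mono) auto
      then show ?thesis
        using r by (simp add: f0 c_def)
    qed
    have fz: "fund z y \<ge> 0" for y
      by (simp add: fund_def)
    show ?thesis
    proof (rule min_principle[OF oT all(1) _ _ yT])
      fix x assume "x \<in> T"
      then show "lap (\<lambda>y. w y - c * fund 0 y + \<eta> * fund z y) x \<le> 0"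
        using S(3)[of x] TS by (simp add: all(2) d(2) c0(2) c1(2) f(2,4) subset_iff)
    next
      fix e :: real assume e: "e > 0"
      text \<open>Near the puncture the fundamental solution dominates, and far out every term is small.\<close>
      define \<rho> where "\<rho> = (w b / \<eta>) powr (1 / m)"
      define R where "R = (e / (2 * c)) powr (1 / m)"
      have \<rho>: "\<rho> > 0" and R: "R > 0"
        using wb \<eta> e c by (auto simp: \<rho>_def R_def)
      define K where "K = {y. r1 \<le> norm y \<and> norm y \<le> R \<and> \<rho> \<le> norm (y - z)}"
      have cK: "compact K"
        unfolding compact_eq_bounded_closed
      proof
        show "bounded K"
          by (rule bounded_subset[of "cball 0 R"]) (auto simp: K_def)
        show "closed K"
          unfolding K_def by (intro closed_Collect_conj closed_Collect_le continuous_intros)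
      qed
      let ?W = "\<lambda>y. w y - c * fund 0 y + \<eta> * fund z y"
      have KS: "K \<subseteq> S" "z \<notin> K" "0 \<notin> K"
        using r \<rho> by (auto simp: K_def S(1))
      have contK: "continuous_on K ?W"
        unfolding fund_def using KS
        by (intro continuous_intros continuous_on_subset[OF contS]) auto
      have eq: "{y \<in> T. ?W y \<le> - e} = K \<inter> ?W -` {.. - e}"
      proof (intro equalityI subsetI)
        fix y assume "y \<in> {y \<in> T. ?W y \<le> - e}"
        then have y: "y \<in> T" "?W y \<le> - e" by auto
        have wy: "w y \<ge> 0"
          using nonneg y(1) TS by auto
        have "norm y \<le> R"
        proof (rule ccontr)
          assume "\<not> norm y \<le> R"
          then have "norm y powr m < R powr m"
            using R m by (intro powr_less_mono2_neg) auto
          also have "R powr m = e / (2 * c)"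
            using m e c by (simp add: R_def powr_powr)
          finally have "c * fund 0 y < e / 2"
            using c by (simp add: f0 field_simps)
          then show False
            using y(2) wy mult_nonneg_nonneg[OF less_imp_le[OF \<eta>] fz[of y]] e by linarith
        qed
        moreover have "\<rho> \<le> norm (y - z)"
        proof (rule ccontr)
          assume "\<not> \<rho> \<le> norm (y - z)"
          moreover have "y \<noteq> z" using y(1) by (auto simp: T_def)
          ultimately have "\<rho> powr m < norm (y - z) powr m"
            using m by (intro powr_less_mono2_neg) auto
          moreover have "\<rho> powr m = w b / \<eta>"
            using m wb \<eta> by (simp add: \<rho>_def powr_powr)
          ultimately have "w b < \<eta> * fund z y"
            using \<eta> mult_strict_left_mono[of "\<rho> powr m" "norm (y - z) powr m" \<eta>]
            by (simp add: fund_def m_def)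
          moreover have "c * fund 0 y \<le> w b"
            using fb[of y] y(1) by (simp add: T_def)
          ultimately show False
            using y(2) wy e by linarith
        qed
        ultimately show "y \<in> K \<inter> ?W -` {.. - e}"
          using y by (auto simp: K_def T_def)
      next
        fix y assume "y \<in> K \<inter> ?W -` {.. - e}"
        then have y: "y \<in> K" "?W y \<le> - e" by auto
        \<comment> \<open>The set \<open>K\<close> is closed and includes the inner sphere, but
          there the comparison is nonnegative, so the sphere adds nothing to the sublevel
          set.\<close>
        have "norm y \<noteq> r1"
        proof
          assume "norm y = r1"
          then have "w b \<le> w y" "c * fund 0 y \<le> w b"
            using b(2)[of y] fb[of y] by auto
          then show False
            using y(2) e mult_nonneg_nonneg[OF less_imp_le[OF \<eta>] fz[of y]] by linarith
        qed
        then show "y \<in> {y \<in> T. ?W y \<le> - e}"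
          using y KS by (auto simp: K_def T_def)
      qed
      have "closed (K \<inter> ?W -` {.. - e})"
        by (rule continuous_closed_preimage[OF contK compact_imp_closed[OF cK]]) auto
      then show "compact {y \<in> T. ?W y \<le> - e}"
        unfolding eq using cK by (metis compact_Int_closed inf.absorb2 inf_le1)
    qed
  qed
  have "c * norm y powr m \<le> w y" if y: "r1 \<le> norm y" "y \<noteq> z" for y
  proof (cases "norm y = r1")
    case True
    then show ?thesis
      using b(2)[of y] r by (simp add: c_def)
  next
    case False
    then have yT: "y \<in> T"
      using y by (auto simp: T_def)
    \<comment> \<open>For a fixed \<open>y\<close> the term with pole \<open>z\<close> vanishes in
      the limit, which removes the puncture.\<close>
    have "\<forall>\<^sub>F \<eta> in at_right 0. 0 \<le> w y - c * fund 0 y + \<eta> * fund z y"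
      using main[OF _ yT] by (auto simp: eventually_at_right_less intro: eventually_mono[OF eventually_at_right_less])
    moreover have "((\<lambda>\<eta>. w y - c * fund 0 y + \<eta> * fund z y) \<longlongrightarrow> w y - c * fund 0 y + 0 * fund z y) (at_right 0)"
      by (intro tendsto_intros)
    ultimately have "0 \<le> w y - c * fund 0 y + 0 * fund z y"
      by (intro tendsto_lowerbound[where F = "at_right (0::real)"]) auto
    then show ?thesis
      by (simp add: f0)
  qed
  then show ?thesis
    using c unfolding m_def by blast
qed

subsection \<open>Moving spheres for a single function\<close>

text \<open>This is the derivative at \<open>t = 1\<close> of
  \<open>t powr ((n - 2) / 2) * f (t *\<^sub>R y)\<close>, the quantity that Kelvin transforms
  reflect.\<close>

definition rad :: "(real^'n::finite \<Rightarrow> real) \<Rightarrow> real^'n \<Rightarrow> real" where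
  "rad f y = (real CARD('n) - 2) / 2 * f y + (\<Sum>i\<in>UNIV. y $ i * pd i f y)"

lemma continuous_on_rad:
  assumes "twice_diff S f"
  shows "continuous_on S (rad f)"
  unfolding rad_def
  by (intro continuous_intros twice_diff_continuous_on[OF assms] twice_diff_continuous_on_pd[OF assms])

lemma isCont_off_point:
  fixes z :: "'a::t2_space"
  assumes "continuous_on (- {z}) f" "y \<noteq> z"
  shows "isCont f y"
proof -
  have "open (- {z})"
    by (rule open_Compl) simp
  then show ?thesis
    using assms by (simp add: continuous_on_eq_continuous_at)
qed

text \<open>The point \<open>z\<close> is excluded because \<open>f z\<close> is an arbitrary value
  at the singularity. On the sphere itself the inequality is an equality.\<close>

definition below :: "real \<Rightarrow> real^'n::finite \<Rightarrow> (real^'n \<Rightarrow> real) \<Rightarrow> bool" where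
  "below \<rho> z f \<longleftrightarrow> (\<forall>y. \<rho> \<le> norm y \<and> y \<noteq> z \<longrightarrow> kelvin \<rho> f y \<le> f y)"

lemma kelvin_on_sphere: "\<rho> > 0 \<Longrightarrow> norm y = \<rho> \<Longrightarrow> kelvin \<rho> f y = f y"
  by (simp add: kelvin_def)

lemma norm_inversion: "norm ((\<rho>\<^sup>2 / (norm y)\<^sup>2) *\<^sub>R y) = \<rho>\<^sup>2 / norm y"
  by (simp add: power2_eq_square)

lemma norm_inversion_le:
  assumes "0 < \<rho>" "\<rho> \<le> norm y"
  shows "norm ((\<rho>\<^sup>2 / (norm y)\<^sup>2) *\<^sub>R y) \<le> \<rho>"
proof -
  have "\<rho> * \<rho> \<le> \<rho> * norm y"
    using assms by (intro mult_left_mono) auto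
  then show ?thesis
    unfolding norm_inversion using assms by (simp add: power2_eq_square divide_le_eq)
qed

text \<open>This makes the Kelvin transform regular on the whole closed exterior, including at
  \<open>z\<close>, where \<open>f\<close> itself is singular.\<close>

lemma inversion_neq:
  assumes "0 < \<rho>" "\<rho> < norm z" "\<rho> \<le> norm y"
  shows "(\<rho>\<^sup>2 / (norm y)\<^sup>2) *\<^sub>R y \<noteq> z"
proof
  assume "(\<rho>\<^sup>2 / (norm y)\<^sup>2) *\<^sub>R y = z"
  then have "norm z \<le> \<rho>"
    using norm_inversion_le[OF assms(1,3)] by (simp only:)
  then show False
    using assms(2) by simp
qed

lemma has_real_derivative_ray:
  fixes f :: "real^'n::finite \<Rightarrow> real"
  assumes "f differentiable (at (t *\<^sub>R y))"
  shows "((\<lambda>t. f (t *\<^sub>R y)) has_real_derivative (\<Sum>i\<in>UNIV. y $ i * pd i f (t *\<^sub>R y))) (at t)"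
proof -
  have "((\<lambda>t. t *\<^sub>R y) has_derivative (\<lambda>h. h *\<^sub>R y)) (at t)"
    by (auto intro!: derivative_eq_intros)
  from has_derivative_compose[OF this has_derivative_pd[OF assms]]
  have "((\<lambda>t. f (t *\<^sub>R y)) has_derivative (\<lambda>h. (\<Sum>i\<in>UNIV. y $ i * pd i f (t *\<^sub>R y)) * h)) (at t)"
    by (simp add: sum_distrib_left sum_distrib_right mult_ac)
  then show ?thesis
    by (simp add: has_field_derivative_def)
qed

text \<open>Along a ray the Kelvin transform is a reflection of \<open>t powr (n/2 - 1) * f (t *\<^sub>R y)\<close>
  in the variable \<open>ln t\<close>.\<close>

lemma kelvin_mvt:
  fixes f :: "real^'n::finite \<Rightarrow> real"
  assumes \<rho>: "0 < \<rho>" "\<rho> < norm y" and d: "\<And>t. 0 \<le> t \<Longrightarrow> t \<le> 1 \<Longrightarrow> f differentiable (at (t *\<^sub>R y))"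
    and less: "f y < kelvin \<rho> f y"
  shows "\<exists>t. \<rho>\<^sup>2 / (norm y)\<^sup>2 < t \<and> t < 1 \<and> rad f (t *\<^sub>R y) < 0"
proof -
  define \<kappa> where "\<kappa> = \<rho>\<^sup>2 / (norm y)\<^sup>2"
  define p where "p = (real CARD('n) - 2) / 2"
  have \<kappa>: "0 < \<kappa>" "\<kappa> < 1"
    using \<rho> power_strict_mono[of \<rho> "norm y" 2] by (auto simp: \<kappa>_def divide_less_eq zero_less_divide_iff)
  \<comment> \<open>Since \<kappa> is the square of \<open>\<rho> / norm y\<close>, the Kelvin
    transform at \<open>y\<close> is the value at \<open>t = \<kappa>\<close> of
    \<open>t powr p * f (t *\<^sub>R y)\<close>, and \<open>f y\<close> is its value at
    \<open>t = 1\<close>.\<close>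
  have 1: "(\<rho> / norm y) powr (real CARD('n) - 2) = \<kappa> powr p"
  proof -
    have "\<kappa> = (\<rho> / norm y) powr 2"
      using \<rho> by (simp add: \<kappa>_def power_divide)
    moreover have "2 * p = real CARD('n) - 2"
      by (simp add: p_def)
    ultimately show ?thesis
      by (simp only: powr_powr)
  qed
  have der: "((\<lambda>t. t powr p * f (t *\<^sub>R y)) has_real_derivative t powr (p - 1) * rad f (t *\<^sub>R y)) (at t)"
    if "\<kappa> \<le> t" "t \<le> 1" for t
  proof -
    have t: "t > 0" using that \<kappa> by simp
    have "((\<lambda>t. t powr p * f (t *\<^sub>R y)) has_real_derivative
        (p * t powr (p - 1)) * f (t *\<^sub>R y) + (\<Sum>i\<in>UNIV. y $ i * pd i f (t *\<^sub>R y)) * t powr p) (at t)"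
      by (rule DERIV_mult[OF has_real_derivative_powr[OF t] has_real_derivative_ray]) (use d that t in auto)
    moreover have "t powr p = t powr (p - 1) * t"
      using t by (simp add: powr_diff)
    then have "(p * t powr (p - 1)) * f (t *\<^sub>R y) + (\<Sum>i\<in>UNIV. y $ i * pd i f (t *\<^sub>R y)) * t powr p
       = t powr (p - 1) * rad f (t *\<^sub>R y)"
      by (simp add: rad_def p_def algebra_simps sum_distrib_left)
    ultimately show ?thesis by simp
  qed
  obtain t where t: "\<kappa> < t" "t < 1" "1 powr p * f (1 *\<^sub>R y) - \<kappa> powr p * f (\<kappa> *\<^sub>R y) = (1 - \<kappa>) * (t powr (p - 1) * rad f (t *\<^sub>R y))"
    using MVT2[OF \<kappa>(2) der] by blast
  have "kelvin \<rho> f y = \<kappa> powr p * f (\<kappa> *\<^sub>R y)"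
    by (simp add: kelvin_def 1 flip: \<kappa>_def)
  then have "(1 - \<kappa>) * (t powr (p - 1) * rad f (t *\<^sub>R y)) < 0"
    using t(3) less by simp
  then have "rad f (t *\<^sub>R y) < 0"
    using \<kappa> t by (simp add: mult_less_0_iff)
  then show ?thesis
    using t unfolding \<kappa>_def by blast
qed

text \<open>At the origin the gradient term of \<open>rad f\<close> vanishes, so
  \<open>rad f\<close> is positive nearby and the inequality holds along short rays. Farther out
  \<open>f\<close> decays no faster than \<open>norm y powr (2 - n)\<close>, and the Kelvin
  transform has the same decay with a coefficient that is small with \<rho>.\<close>

lemma below_small:
  fixes f :: "real^'n::finite \<Rightarrow> real"
  assumes n: "CARD('n) \<ge> 3" and z: "z \<noteq> 0" and f: "twice_diff (- {z}) f"
    and sup: "\<And>y. y \<noteq> z \<Longrightarrow> lap f y \<le> 0" and pos: "\<And>y. y \<noteq> z \<Longrightarrow> f y > 0"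
  shows "\<exists>\<rho>0>0. \<forall>\<rho>. 0 < \<rho> \<and> \<rho> < \<rho>0 \<longrightarrow> below \<rho> z f"
proof -
  define m where "m = real CARD('n) - 2"
  have m: "m > 0" using n by (simp add: m_def)
  have "isCont (rad f) 0" "isCont f 0"
    using isCont_off_point[OF continuous_on_rad[OF f]] isCont_off_point[OF twice_diff_continuous_on[OF f]] z
    by auto
  moreover have f0: "f 0 > 0"
    using pos z by simp
  moreover have "rad f 0 > 0"
    using f0 m by (simp add: rad_def m_def)
  ultimately have "\<forall>\<^sub>F y in nhds 0. rad f y > 0" "\<forall>\<^sub>F y in nhds 0. f y < 2 * f 0"
    by (auto intro!: order_tendstoD simp: isCont_def tendsto_at_iff_tendsto_nhds)
  then have "\<forall>\<^sub>F y in nhds 0. rad f y > 0 \<and> f y < 2 * f 0"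
    by eventually_elim auto
  then obtain d where d: "d > 0" "\<And>y. norm y < d \<Longrightarrow> rad f y > 0 \<and> f y < 2 * f 0"
    unfolding eventually_nhds_metric dist_norm by auto
  define r1 where "r1 = min d (norm z) / 2"
  have r1: "0 < r1 / 2" "r1 / 2 < r1" "r1 < norm z" "r1 < d"
    using d z zero_less_norm_iff[of z] unfolding r1_def min_def by (simp_all del: zero_less_norm_iff)
  let ?S = "{y. r1 / 2 < norm y} - {z}"
  have "\<exists>c>0. \<forall>y. r1 \<le> norm y \<and> y \<noteq> z \<longrightarrow> c * norm y powr (2 - real CARD('n)) \<le> f y"
  proof (rule exterior_lower_bound[OF n r1(1-3) refl])
    show "twice_diff ?S f"
      by (rule twice_diff_subset[OF f]) auto
    show "f y > 0" if "norm y = r1" for y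
      by (rule pos) (use that r1 in auto)
  qed (use sup pos in \<open>auto intro: less_imp_le\<close>)
  then obtain c where c: "c > 0" "\<And>y. r1 \<le> norm y \<Longrightarrow> y \<noteq> z \<Longrightarrow> c * norm y powr (2 - real CARD('n)) \<le> f y"
    by blast
  \<comment> \<open>The second bound is the solution of
    \<open>\<rho> powr m * (2 * f 0) = c\<close>.\<close>
  define \<rho>0 where "\<rho>0 = min r1 ((c / (2 * f 0)) powr (1 / m))"
  have "\<rho>0 > 0"
    using r1 c f0 by (simp add: \<rho>0_def)
  moreover have "below \<rho> z f" if \<rho>: "0 < \<rho>" "\<rho> < \<rho>0" for \<rho>
    unfolding below_def
  proof (intro allI impI, elim conjE)
    fix y assume y: "\<rho> \<le> norm y" "y \<noteq> z"
    consider "norm y = \<rho>" | "\<rho> < norm y" "norm y < r1" | "r1 \<le> norm y"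
      using y by linarith
    then show "kelvin \<rho> f y \<le> f y"
    proof cases
      case 1
      then show ?thesis by (simp add: kelvin_on_sphere[OF \<rho>(1)])
    next
      case 2
      have ty: "norm (t *\<^sub>R y) < r1" if "0 \<le> t" "t \<le> 1" for t
        using that 2 mult_left_le_one_le[of "norm y" t] by simp
      show ?thesis
      proof (rule ccontr)
        assume "\<not> kelvin \<rho> f y \<le> f y"
        then obtain t where t: "\<rho>\<^sup>2 / (norm y)\<^sup>2 < t" "t < 1" "rad f (t *\<^sub>R y) < 0"
          using kelvin_mvt[OF \<rho>(1) 2(1), of f] ty r1 twice_diffD(1)[OF f] by force
        moreover have "0 \<le> t"
          using t(1) by (meson less_le_trans less_imp_le zero_le_divide_iff zero_le_power2 order_trans)
        ultimately show False
          using d(2)[of "t *\<^sub>R y"] ty[of t] r1 by force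
      qed
    next
      case 3
      then have y0: "norm y > 0" using r1 by linarith
      have "norm ((\<rho>\<^sup>2 / (norm y)\<^sup>2) *\<^sub>R y) < d"
        using norm_inversion_le[OF \<rho>(1) y(1)] \<rho>(2) r1(4) by (simp add: \<rho>0_def)
      then have "f ((\<rho>\<^sup>2 / (norm y)\<^sup>2) *\<^sub>R y) \<le> 2 * f 0"
        using d(2) less_imp_le by blast
      then have "kelvin \<rho> f y \<le> (\<rho> / norm y) powr m * (2 * f 0)"
        by (simp add: kelvin_def m_def mult_left_mono)
      also have "\<dots> = (\<rho> powr m * (2 * f 0)) * norm y powr (2 - real CARD('n))"
        using \<rho> y0 powr_minus_divide[of "norm y" m] by (simp add: powr_divide m_def)
      also have "\<dots> \<le> c * norm y powr (2 - real CARD('n))"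
      proof (rule mult_right_mono)
        have "\<rho> powr m \<le> ((c / (2 * f 0)) powr (1 / m)) powr m"
          using \<rho> m by (intro powr_mono2) (auto simp: \<rho>0_def)
        also have "\<dots> = c / (2 * f 0)"
          using m c f0 by (simp add: powr_powr)
        finally show "\<rho> powr m * (2 * f 0) \<le> c"
          using f0 by (simp add: field_simps)
      qed simp
      also have "\<dots> \<le> f y"
        using c(2) 3 y by blast
      finally show ?thesis .
    qed
  qed
  ultimately show ?thesis by blast
qed

section \<open>Dependence of the Kelvin inequality on the radius\<close>

lemma tendsto_kelvin:
  fixes f :: "real^'n::finite \<Rightarrow> real"
  assumes "(\<rho> \<longlongrightarrow> \<rho>0) F" "(y \<longlongrightarrow> y0) F" "\<rho>0 > 0" "y0 \<noteq> 0" "isCont f ((\<rho>0\<^sup>2 / (norm y0)\<^sup>2) *\<^sub>R y0)"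
  shows "((\<lambda>k. kelvin (\<rho> k) f (y k)) \<longlongrightarrow> kelvin \<rho>0 f y0) F"
  unfolding kelvin_def
  using assms by (intro tendsto_intros isCont_tendsto_compose[OF assms(5)]) auto

text \<open>A violation is strict and so lies off the sphere. The same point then remains a
  violation for all nearby radii, which gives closedness of the set of admissible radii.\<close>

lemma not_below_open:
  fixes f :: "real^'n::finite \<Rightarrow> real"
  assumes \<rho>: "0 < \<rho>" "\<rho> < norm z" and f: "continuous_on (- {z}) f" and nb: "\<not> below \<rho> z f"
  shows "\<forall>\<^sub>F \<rho>' in nhds \<rho>. \<not> below \<rho>' z f"
proof -
  obtain y where y: "\<rho> \<le> norm y" "y \<noteq> z" "f y < kelvin \<rho> f y"
    using nb by (auto simp: below_def not_le)
  have "norm y \<noteq> \<rho>"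
    using y(3) kelvin_on_sphere[OF \<rho>(1), of y f] by auto
  then have less: "\<rho> < norm y"
    using y by simp
  have "(\<rho>\<^sup>2 / (norm y)\<^sup>2) *\<^sub>R y \<noteq> z"
    by (rule inversion_neq[OF \<rho> y(1)])
  then have "isCont f ((\<rho>\<^sup>2 / (norm y)\<^sup>2) *\<^sub>R y)"
    using isCont_off_point[OF f] by blast
  then have "((\<lambda>\<rho>. kelvin \<rho> f y) \<longlongrightarrow> kelvin \<rho> f y) (nhds \<rho>)"
    using \<rho> less by (intro tendsto_kelvin tendsto_const) (auto simp: filterlim_def)
  then have "\<forall>\<^sub>F \<rho>' in nhds \<rho>. f y < kelvin \<rho>' f y"
    using y(3) by (rule order_tendstoD)
  moreover have "\<forall>\<^sub>F \<rho>' in nhds \<rho>. \<rho>' < norm y"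
    using less by (intro order_tendstoD[of "\<lambda>x. x"]) (auto simp: filterlim_def)
  ultimately show ?thesis
    by eventually_elim (use y(2) in \<open>force simp: below_def not_le\<close>)
qed

text \<open>The inversion sends \<open>z\<close> to norm \<open>\<rho>\<^sup>2 / norm z\<close>,
  which is less than \<rho>. The transform is thus smooth on an open set containing the closed
  exterior, as derivatives on the sphere require.\<close>

lemma twice_diff_kelvin:
  fixes f :: "real^'n::finite \<Rightarrow> real"
  assumes \<rho>: "0 < \<rho>" "\<rho> < norm z" and f: "twice_diff (- {z}) f"
  shows "twice_diff {y. \<rho>\<^sup>2 / norm z < norm y} (kelvin \<rho> f)"
    and "\<rho>\<^sup>2 / norm z < norm y \<Longrightarrow> lap (kelvin \<rho> f) y
       = (\<rho> / norm y) powr (real CARD('n) + 2) * lap f ((\<rho>\<^sup>2 / (norm y)\<^sup>2) *\<^sub>R y)"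
proof -
  have z: "norm z > 0" using \<rho> by linarith
  have o: "open {y::real^'n. \<rho>\<^sup>2 / norm z < norm y}"
    by (intro open_Collect_less continuous_intros)
  have oz: "open (- {z})"
    by (rule open_Compl) simp
  have inv: "y \<noteq> 0 \<and> (\<rho>\<^sup>2 / (norm y)\<^sup>2) *\<^sub>R y \<in> - {z}" if "y \<in> {y. \<rho>\<^sup>2 / norm z < norm y}" for y :: "real^'n"
  proof -
    have "y \<noteq> 0"
      using that z zero_le_power2[of \<rho>] by (auto simp: divide_less_0_iff)
    moreover have "\<rho>\<^sup>2 / norm y < norm z"
      using that z \<open>y \<noteq> 0\<close> by (simp add: divide_less_eq mult.commute)
    ultimately show ?thesis
      using norm_inversion[of \<rho> y] by auto
  qed
  note k = twice_diff_lap_kelvin[OF \<rho>(1) oz f o inv]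
  show "twice_diff {y. \<rho>\<^sup>2 / norm z < norm y} (kelvin \<rho> f)"
    using k(1) by blast
  show "lap (kelvin \<rho> f) y
       = (\<rho> / norm y) powr (real CARD('n) + 2) * lap f ((\<rho>\<^sup>2 / (norm y)\<^sup>2) *\<^sub>R y)"
    if "\<rho>\<^sup>2 / norm z < norm y"
    using k(2)[of y] that by blast
qed

lemma sq_div_less: "0 < \<rho> \<Longrightarrow> \<rho> < r \<Longrightarrow> \<rho>\<^sup>2 / r < (\<rho>::real)"
  by (simp add: power2_eq_square divide_less_eq mult_strict_left_mono)

text \<open>The Hopf lemma on the sphere: the radial derivative of \<open>f - kelvin \<rho> f\<close> there is
  \<open>2 / \<rho> * rad f\<close>.\<close>

lemma rad_pos:
  fixes f :: "real^'n::finite \<Rightarrow> real"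
  assumes n: "CARD('n) \<ge> 3" and \<rho>: "0 < \<rho>" "\<rho> < norm z" and f: "twice_diff (- {z}) f"
    and sup: "\<And>y. \<rho> < norm y \<Longrightarrow> y \<noteq> z \<Longrightarrow> lap (\<lambda>y. f y - kelvin \<rho> f y) y \<le> 0"
    and pos: "\<And>y. \<rho> < norm y \<Longrightarrow> y \<noteq> z \<Longrightarrow> kelvin \<rho> f y < f y"
    and y: "norm y = \<rho>"
  shows "rad f y > 0"
proof -
  define m where "m = real CARD('n) - 2"
  have m: "m > 0" using n by (simp add: m_def)
  define w where "w = (\<lambda>y. f y - kelvin \<rho> f y)"
  define R where "R = (\<rho> + norm z) / 2"
  have R: "\<rho> < R" "R < norm z"
    using \<rho> by (auto simp: R_def)
  define U where "U = {y. \<rho>\<^sup>2 / norm z < norm y} \<inter> - {z}"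
  have oU: "open U"
    unfolding U_def by (intro open_Int open_Collect_less continuous_intros open_Compl closed_singleton)
  have tdw: "twice_diff U w"
    unfolding w_def
    by (rule twice_diff_lap_diff(1)[OF oU]; rule twice_diff_subset)
      (use f twice_diff_kelvin(1)[OF \<rho> f] in \<open>auto simp: U_def\<close>)
  have inU: "x \<in> U" if "\<rho> \<le> norm x" "x \<noteq> z" for x
    using that sq_div_less[OF \<rho>] by (auto simp: U_def)
  have cw: "continuous_on U w"
    by (rule twice_diff_continuous_on[OF tdw])
  have sph: "sphere 0 R \<subseteq> U"
    using R by (auto intro!: inU)
  obtain k :: "real^'n" where "norm k = R"
    using vector_choose_size[of R] R \<rho> by auto
  then have "sphere (0::real^'n) R \<noteq> {}"
    by (metis dist_0_norm empty_iff mem_sphere)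
  then obtain b where b: "b \<in> sphere 0 R" "\<And>y. y \<in> sphere 0 R \<Longrightarrow> w b \<le> w y"
    using continuous_attains_inf[OF compact_sphere _ continuous_on_subset[OF cw sph]] by blast
  have wb: "w b > 0"
    using pos[of b] b(1) R by (force simp: w_def)
  define D where "D = \<rho> powr (- m) - R powr (- m)"
  have D: "D > 0"
    using powr_dim_less[OF n \<rho>(1) R(1)] by (simp add: D_def m_def)
  \<comment> \<open>The barrier \<open>C * (\<rho> powr (- m) - fund 0 x)\<close> is 0 on the inner
    sphere and equals \<open>w b\<close> on the sphere of radius \<open>R\<close>.\<close>
  define C where "C = w b / D"
  have C: "C > 0"
    using wb D by (simp add: C_def)
  have low: "C * \<rho> powr (- m) + (- C) * fund 0 x \<le> w x" if x: "\<rho> \<le> norm x" "norm x \<le> R" for x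
  proof (rule annulus_comparison[OF \<rho>(1) refl refl, where a = 0 and R = R])
    show "continuous_on {y. \<rho> \<le> norm (y - 0) \<and> norm (y - 0) \<le> R} w"
      by (rule continuous_on_subset[OF cw]) (use R in \<open>auto intro!: inU\<close>)
    show "twice_diff {y. \<rho> < norm (y - 0) \<and> norm (y - 0) < R} w"
      by (rule twice_diff_subset[OF tdw]) (use R in \<open>auto intro!: inU\<close>)
    show "lap w v \<le> 0" if "v \<in> {y. \<rho> < norm (y - 0) \<and> norm (y - 0) < R}" for v
    proof -
      have "\<rho> < norm v" "v \<noteq> z"
        using that R by auto
      then show ?thesis
        using sup unfolding w_def by blast
    qed
    show "C * \<rho> powr (- m) + (- C) * fund 0 v \<le> w v"
      if "v \<in> {y. \<rho> \<le> norm (y - 0) \<and> norm (y - 0) \<le> R}" "norm (v - 0) = \<rho> \<or> norm (v - 0) = R" for v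
      using that(2)
    proof
      assume "norm (v - 0) = \<rho>"
      then show ?thesis
        using kelvin_on_sphere[OF \<rho>(1), of v f] by (simp add: fund_def m_def w_def)
    next
      assume v: "norm (v - 0) = R"
      have "C * \<rho> powr (- m) + (- C) * fund 0 v = C * D"
        using v by (simp add: fund_def m_def D_def algebra_simps)
      then show ?thesis
        using b(2)[of v] v D by (simp add: C_def)
    qed
  qed (use x in auto)
  have yz: "y \<noteq> z"
    using y \<rho> by auto
  have dy: "f differentiable (at (1 *\<^sub>R y))"
    using twice_diffD(1)[OF f] yz by simp
  define E where "E = (\<Sum>i\<in>UNIV. y $ i * pd i f y)"
  \<comment> \<open>This is the gap minus the barrier along the ray through \<open>y\<close>. It is
    0 at \<open>t = 1\<close> and nonnegative just beyond, so its derivative at 1, which is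
    \<open>2 * rad f y - C * \<rho> powr (- m) * m\<close>, is nonnegative.\<close>
  define g where "g = (\<lambda>t. f (t *\<^sub>R y) - t powr (- m) * f ((1 / t) *\<^sub>R y) - C * \<rho> powr (- m) * (1 - t powr (- m)))"
  have g: "g t \<ge> 0" if t: "1 < t" "t < R / \<rho>" for t
  proof -
    have ty: "norm (t *\<^sub>R y) = t * \<rho>"
      using t y by simp
    have le: "\<rho> \<le> norm (t *\<^sub>R y)" "norm (t *\<^sub>R y) \<le> R"
      unfolding ty using t \<rho> by (auto simp: less_divide_eq)
    have "\<rho> / (t * \<rho>) = 1 / t" "\<rho>\<^sup>2 / (t * \<rho>)\<^sup>2 * t = 1 / t"
      using t \<rho> by (auto simp: field_simps power2_eq_square)
    then have "kelvin \<rho> f (t *\<^sub>R y) = (1 / t) powr m * f ((1 / t) *\<^sub>R y)"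
      unfolding kelvin_def ty by (simp add: m_def)
    also have "(1 / t) powr m = t powr (- m)"
      using t by (simp add: powr_minus_divide powr_divide)
    finally have "w (t *\<^sub>R y) = f (t *\<^sub>R y) - t powr (- m) * f ((1 / t) *\<^sub>R y)"
      by (simp add: w_def)
    moreover have "fund 0 (t *\<^sub>R y) = t powr (- m) * \<rho> powr (- m)"
      using ty t \<rho> by (simp add: fund_def m_def powr_mult del: norm_scaleR)
    ultimately show ?thesis
      using low[OF le] by (simp add: g_def algebra_simps)
  qed
  have d1: "((\<lambda>t. f (t *\<^sub>R y)) has_real_derivative E) (at 1)"
    using has_real_derivative_ray[OF dy] by (simp add: E_def)
  have d2: "((\<lambda>t. t powr (- m)) has_real_derivative - m) (at 1)"
    using has_real_derivative_powr[of 1 "- m"] by simp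
  have "((\<lambda>t. 1 / t) has_real_derivative - 1) (at 1)"
    by (auto intro!: derivative_eq_intros)
  then have d3: "((\<lambda>t. f ((1 / t) *\<^sub>R y)) has_real_derivative - E) (at 1)"
    using DERIV_chain2[of "\<lambda>t. f (t *\<^sub>R y)" E "\<lambda>t. 1 / t" 1 "-1" UNIV] d1 by simp
  have "(g has_real_derivative E - (1 powr (- m) * (- E) + (- m) * f ((1 / 1) *\<^sub>R y)) - (C * \<rho> powr (- m) * (0 - (- m)))) (at 1)"
    unfolding g_def
    by (intro DERIV_diff d1 DERIV_mult' d2 d3 DERIV_cmult DERIV_const)
  moreover have "E - (1 powr (- m) * (- E) + (- m) * f ((1 / 1) *\<^sub>R y)) - (C * \<rho> powr (- m) * (0 - (- m)))
      = 2 * rad f y - C * \<rho> powr (- m) * m"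
    by (simp add: rad_def E_def m_def field_simps)
  ultimately have "(g has_real_derivative (2 * rad f y - C * \<rho> powr (- m) * m)) (at 1)"
    by simp
  moreover have g1: "g 1 = 0"
    by (simp add: g_def)
  ultimately have "2 * rad f y - C * \<rho> powr (- m) * m \<ge> 0"
  proof (rule_tac ccontr)
    assume der: "(g has_real_derivative (2 * rad f y - C * \<rho> powr (- m) * m)) (at 1)"
      and "\<not> 2 * rad f y - C * \<rho> powr (- m) * m \<ge> 0"
    then obtain d where d: "d > 0" "\<And>h. 0 < h \<Longrightarrow> h < d \<Longrightarrow> g (1 + h) < g 1"
      using DERIV_neg_dec_right[OF der] by auto
    have h0: "R / \<rho> - 1 > 0"
      using R \<rho> by (simp add: less_divide_eq)
    then obtain h where "0 < h" "h < min d (R / \<rho> - 1)"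
      using d(1) dense[of 0 "min d (R / \<rho> - 1)"] by auto
    then show False
      using d(2)[of h] g[of "1 + h"] g1 by simp
  qed
  moreover have "C * \<rho> powr (- m) * m > 0"
    using C \<rho> m by simp
  ultimately show ?thesis by linarith
qed

text \<open>Violations for radii tending to \<rho> subconverge after inversion. A limit beyond
  \<open>r1\<close>, infinity included, contradicts the bound with \<open>c\<close>; one on the
  sphere contradicts \<open>rad f > 0\<close>; one in between contradicts strict positivity of the
  gap.\<close>

lemma below_open:
  fixes f :: "real^'n::finite \<Rightarrow> real"
  assumes n: "CARD('n) \<ge> 3" and \<rho>: "0 < \<rho>" "\<rho> < norm z" and f: "twice_diff (- {z}) f"
    and pos: "\<And>y. \<rho> < norm y \<Longrightarrow> y \<noteq> z \<Longrightarrow> kelvin \<rho> f y < f y"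
    and c: "c > 0" "r1 < norm z" "0 < r1"
      "\<And>y. r1 \<le> norm y \<Longrightarrow> y \<noteq> z \<Longrightarrow> kelvin \<rho> f y + c * norm y powr (2 - real CARD('n)) \<le> f y"
    and rad: "\<And>y. norm y = \<rho> \<Longrightarrow> rad f y > 0"
  shows "\<forall>\<^sub>F \<rho>' in nhds \<rho>. below \<rho>' z f"
proof (rule ccontr)
  assume neg: "\<not> ?thesis"
  define m where "m = real CARD('n) - 2"
  have m: "m > 0" using n by (simp add: m_def)
  note contf = twice_diff_continuous_on[OF f]
  \<comment> \<open>The prefactor keeps all perturbed radii between \<open>\<rho> / 2\<close> and
    \<open>norm z\<close>.\<close>
  define e where "e k = min (\<rho> / 2) (norm z - \<rho>) * inverse (real (Suc k))" for k
  have e0: "min (\<rho> / 2) (norm z - \<rho>) > 0"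
    using \<rho> by auto
  have epos: "e k > 0" for k
    using e0 by (simp add: e_def)
  have ele: "e k \<le> min (\<rho> / 2) (norm z - \<rho>)" for k
    unfolding e_def using e0 by (intro mult_left_le) (auto simp: inverse_le_1_iff)
  have elim: "e \<longlonglongrightarrow> 0"
    unfolding e_def using tendsto_mult_right_zero[OF LIMSEQ_inverse_real_of_nat] by fast
  have "\<exists>\<rho>' y. \<bar>\<rho>' - \<rho>\<bar> < e k \<and> \<rho>' \<le> norm y \<and> y \<noteq> z \<and> f y < kelvin \<rho>' f y" for k
    using neg epos[of k] unfolding eventually_nhds_metric dist_real_def below_def by (auto simp: not_le)
  then obtain \<rho>' y where ry: "\<And>k. \<bar>\<rho>' k - \<rho>\<bar> < e k" "\<And>k. \<rho>' k \<le> norm (y k)" "\<And>k. y k \<noteq> z"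
      "\<And>k. f (y k) < kelvin (\<rho>' k) f (y k)"
    by metis
  have \<rho>': "\<rho>' k > \<rho> / 2" "\<rho>' k < norm z" for k
    using ry(1)[of k] ele[of k] by auto
  have \<rho>'0: "\<rho>' k > 0" for k
    using \<rho>'(1)[of k] \<rho>(1) by linarith
  have less: "\<rho>' k < norm (y k)" for k
    using ry(2)[of k] ry(4)[of k] kelvin_on_sphere[OF \<rho>'0, of "y k" k f] by (cases "\<rho>' k = norm (y k)") auto
  have y0: "norm (y k) > 0" for k
    using less[of k] \<rho>'0[of k] by linarith
  have \<rho>'lim: "\<rho>' \<longlonglongrightarrow> \<rho>"
  proof -
    have "(\<lambda>k. \<rho>' k - \<rho>) \<longlonglongrightarrow> 0"
      by (rule Lim_null_comparison[OF _ elim]) (use ry(1) in \<open>auto simp: less_imp_le\<close>)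
    then show ?thesis
      by (simp add: LIM_zero_iff)
  qed
  text \<open>Passing to the inverted points \<open>p\<close> turns escape to infinity into convergence to 0.\<close>
  define p where "p k = (1 / (norm (y k))\<^sup>2) *\<^sub>R y k" for k
  have np: "norm (p k) = 1 / norm (y k)" for k
    using y0[of k] by (simp add: p_def power2_eq_square)
  have yp: "y k = (1 / (norm (p k))\<^sup>2) *\<^sub>R p k" for k
    using y0[of k] unfolding np by (simp add: p_def power2_eq_square)
  have np_less: "norm (p k) < 1 / \<rho>' k" for k
    unfolding np using less[of k] \<rho>'0[of k] by (simp add: frac_less2)
  have "norm (p k) \<le> 2 / \<rho>" for k
    using np_less[of k] \<rho>'(1)[of k] \<rho>(1) frac_less2[of 1 1 "\<rho> / 2" "\<rho>' k"] by simp
  then have "bounded (range p)"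
    by (auto simp: bounded_iff)
  then obtain q s where qs: "strict_mono (s :: nat \<Rightarrow> nat)" "(p \<circ> s) \<longlonglongrightarrow> q"
    using bounded_imp_convergent_subsequence by blast
  have ps: "(\<lambda>k. p (s k)) \<longlonglongrightarrow> q" and \<rho>s: "(\<lambda>k. \<rho>' (s k)) \<longlonglongrightarrow> \<rho>"
    using qs LIMSEQ_subseq_LIMSEQ[OF \<rho>'lim qs(1)] by (simp_all add: o_def)
  have "norm q \<le> 1 / \<rho>"
    by (rule LIMSEQ_le[OF tendsto_norm[OF ps] tendsto_divide[OF tendsto_const \<rho>s]])
      (use \<rho> np_less in \<open>auto intro: less_imp_le\<close>)
  \<comment> \<open>The factor \<open>norm (p k) powr m\<close> is exactly the rate in the lower
    bound. Dividing by it leaves terms that converge even when the \<open>y k\<close> escape to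
    infinity.\<close>
  have kel: "kelvin r f (y k) = r powr m * norm (p k) powr m * f (r\<^sup>2 *\<^sub>R p k)" if "r > 0" for r k
  proof -
    have "kelvin r f (y k) = (r * (1 / norm (y k))) powr m * f (r\<^sup>2 *\<^sub>R p k)"
      by (simp add: kelvin_def m_def p_def)
    also have "\<dots> = r powr m * norm (p k) powr m * f (r\<^sup>2 *\<^sub>R p k)"
      unfolding np[symmetric] using that by (simp add: powr_mult)
    finally show ?thesis .
  qed
  have nyp: "norm (y k) powr (2 - real CARD('n)) = norm (p k) powr m" for k
    using y0[of k] powr_minus_divide[of "norm (y k)" m] by (simp add: np powr_divide m_def)
  have "norm (\<rho>\<^sup>2 *\<^sub>R q) \<le> \<rho>"
    using \<open>norm q \<le> 1 / \<rho>\<close> \<rho> by (simp add: field_simps power2_eq_square)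
  then have cq: "isCont f (\<rho>\<^sup>2 *\<^sub>R q)"
    using isCont_off_point[OF contf] \<rho> by force
  have lim1: "(\<lambda>k. \<rho>' (s k) powr m * f ((\<rho>' (s k))\<^sup>2 *\<^sub>R p (s k))) \<longlonglongrightarrow> \<rho> powr m * f (\<rho>\<^sup>2 *\<^sub>R q)"
    using \<rho> by (intro tendsto_intros isCont_tendsto_compose[OF cq] \<rho>s ps) auto
  have lim2: "(\<lambda>k. \<rho> powr m * f (\<rho>\<^sup>2 *\<^sub>R p (s k))) \<longlonglongrightarrow> \<rho> powr m * f (\<rho>\<^sup>2 *\<^sub>R q)"
    using \<rho> by (intro tendsto_intros isCont_tendsto_compose[OF cq] ps) auto
  have far: False if ev: "\<forall>\<^sub>F k in sequentially. r1 \<le> norm (y (s k))"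
  proof -
    have "\<forall>\<^sub>F k in sequentially. \<rho> powr m * f (\<rho>\<^sup>2 *\<^sub>R p (s k)) + c \<le> \<rho>' (s k) powr m * f ((\<rho>' (s k))\<^sup>2 *\<^sub>R p (s k))"
      using ev
    proof eventually_elim
      case (elim k)
      let ?P = "norm (p (s k)) powr m"
      have P: "?P > 0"
        using y0[of "s k"] by (simp add: np)
      have "kelvin \<rho> f (y (s k)) + c * ?P \<le> kelvin (\<rho>' (s k)) f (y (s k))"
        using c(4)[OF elim ry(3)] ry(4)[of "s k"] by (simp add: nyp)
      then have "?P * (\<rho> powr m * f (\<rho>\<^sup>2 *\<^sub>R p (s k)) + c) \<le> ?P * (\<rho>' (s k) powr m * f ((\<rho>' (s k))\<^sup>2 *\<^sub>R p (s k)))"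
        by (simp add: kel \<rho>(1) \<rho>'0 algebra_simps)
      then show ?case
        using P by simp
    qed
    then have "\<rho> powr m * f (\<rho>\<^sup>2 *\<^sub>R q) + c \<le> \<rho> powr m * f (\<rho>\<^sup>2 *\<^sub>R q)"
      using tendsto_le[OF _ lim1 tendsto_add[OF lim2 tendsto_const]] by simp
    then show False
      using c(1) by simp
  qed
  \<comment> \<open>Since \<open>r1 < norm z\<close>, points approaching \<open>z\<close> also
    belong to the far case. In the other case the points converge to a limit of norm between \<rho>
    and \<open>r1\<close>, where \<open>f\<close> is continuous.\<close>
  show False
  proof (cases "norm q < 1 / r1")
    case True
    have "\<forall>\<^sub>F k in sequentially. norm (p (s k)) < 1 / r1"
      using order_tendstoD(2)[OF tendsto_norm[OF ps] True] .
    then have "\<forall>\<^sub>F k in sequentially. r1 \<le> norm (y (s k))"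
    proof eventually_elim
      case (elim k)
      then show ?case
        using y0[of "s k"] c(3) by (simp add: np field_simps)
    qed
    then show False by (rule far)
  next
    case False
    then have q0: "q \<noteq> 0"
      using c(3) by auto
    define x where "x = (1 / (norm q)\<^sup>2) *\<^sub>R q"
    have ys: "(\<lambda>k. y (s k)) \<longlonglongrightarrow> x"
      unfolding yp x_def using q0 by (intro tendsto_intros ps) auto
    have nx: "norm x = 1 / norm q"
      using q0 by (simp add: x_def power2_eq_square)
    have x: "norm x \<le> r1" "\<rho> \<le> norm x"
      using False \<open>norm q \<le> 1 / \<rho>\<close> q0 \<rho> c(3) by (auto simp: nx field_simps)
    then have xz: "x \<noteq> z" "x \<noteq> 0"
      using c \<rho> by auto
    show False
    proof (cases "norm x = \<rho>")
      case True
      have "\<forall>\<^sub>F k in sequentially. norm (y (s k)) < norm z"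
        using order_tendstoD(2)[OF tendsto_norm[OF ys]] True \<rho> by auto
      \<comment> \<open>The mean value argument needs the segment from 0 to \<open>y k\<close> to
        avoid \<open>z\<close>, hence the premise. Placing it under the quantifier allows one choice
        of \<open>t\<close> for all \<open>k\<close>; the squeeze then forces \<open>t\<close> to
        1.\<close>
      moreover have "\<exists>t. norm (y k) < norm z \<longrightarrow> (\<rho>' k)\<^sup>2 / (norm (y k))\<^sup>2 \<le> t \<and> t \<le> 1 \<and> rad f (t *\<^sub>R y k) \<le> 0" for k
      proof (cases "norm (y k) < norm z")
        case True
        have "t *\<^sub>R y k \<noteq> z" if "0 \<le> t" "t \<le> 1" for t
        proof -
          have "norm (t *\<^sub>R y k) \<le> norm (y k)"
            using that mult_left_le_one_le[of "norm (y k)" t] by simp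
          then show ?thesis
            using True by auto
        qed
        then have "\<exists>t. (\<rho>' k)\<^sup>2 / (norm (y k))\<^sup>2 < t \<and> t < 1 \<and> rad f (t *\<^sub>R y k) < 0"
          by (intro kelvin_mvt[OF \<rho>'0 less _ ry(4)] twice_diffD(1)[OF f]) auto
        then show ?thesis
          using less_imp_le by blast
      qed auto
      then obtain t where t: "\<And>k. norm (y k) < norm z \<Longrightarrow> (\<rho>' k)\<^sup>2 / (norm (y k))\<^sup>2 \<le> t k \<and> t k \<le> 1 \<and> rad f (t k *\<^sub>R y k) \<le> 0"
        by metis
      ultimately have ev: "\<forall>\<^sub>F k in sequentially. (\<rho>' (s k))\<^sup>2 / (norm (y (s k)))\<^sup>2 \<le> t (s k)"
          "\<forall>\<^sub>F k in sequentially. t (s k) \<le> 1" "\<forall>\<^sub>F k in sequentially. rad f (t (s k) *\<^sub>R y (s k)) \<le> 0"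
        by (auto elim!: eventually_mono)
      have "(\<lambda>k. (\<rho>' (s k))\<^sup>2 / (norm (y (s k)))\<^sup>2) \<longlonglongrightarrow> \<rho>\<^sup>2 / (norm x)\<^sup>2"
        using xz by (intro tendsto_intros \<rho>s ys) auto
      then have "(\<lambda>k. (\<rho>' (s k))\<^sup>2 / (norm (y (s k)))\<^sup>2) \<longlonglongrightarrow> 1"
        using True \<rho> by simp
      then have "(\<lambda>k. t (s k)) \<longlonglongrightarrow> 1"
        using tendsto_sandwich[OF ev(1,2) _ tendsto_const] by blast
      then have "(\<lambda>k. t (s k) *\<^sub>R y (s k)) \<longlonglongrightarrow> x"
        using tendsto_scaleR[OF _ ys] by force
      moreover have "isCont (rad f) x"
        using isCont_off_point[OF continuous_on_rad[OF f] xz(1)] .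
      ultimately have "(\<lambda>k. rad f (t (s k) *\<^sub>R y (s k))) \<longlonglongrightarrow> rad f x"
        by (rule isCont_tendsto_compose[rotated])
      then have "rad f x \<le> 0"
        using ev(3) tendsto_upperbound by fastforce
      then show False
        using rad[OF True] by simp
    next
      case False
      have "(\<rho>\<^sup>2 / (norm x)\<^sup>2) *\<^sub>R x \<noteq> z"
        by (rule inversion_neq[OF \<rho> x(2)])
      then have "isCont f ((\<rho>\<^sup>2 / (norm x)\<^sup>2) *\<^sub>R x)"
        using isCont_off_point[OF contf] by blast
      then have lim: "(\<lambda>k. kelvin (\<rho>' (s k)) f (y (s k))) \<longlonglongrightarrow> kelvin \<rho> f x"
        by (rule tendsto_kelvin[OF \<rho>s ys \<rho>(1) xz(2)])
      have "f x \<le> kelvin \<rho> f x"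
        by (rule LIMSEQ_le[OF isCont_tendsto_compose[OF isCont_off_point[OF contf xz(1)] ys] lim])
          (use ry(4) in \<open>auto intro: less_imp_le\<close>)
      then show False
        using pos[of x] x xz False by force
    qed
  qed
qed

lemma gap_open:
  fixes f :: "real^'n::finite \<Rightarrow> real"
  assumes n: "CARD('n) \<ge> 3" and \<rho>: "0 < \<rho>" "\<rho> < norm z" and f: "twice_diff (- {z}) f"
    and sup: "\<And>y. \<rho> < norm y \<Longrightarrow> y \<noteq> z \<Longrightarrow> lap (\<lambda>y. f y - kelvin \<rho> f y) y \<le> 0"
    and pos: "\<And>y. \<rho> < norm y \<Longrightarrow> y \<noteq> z \<Longrightarrow> kelvin \<rho> f y < f y"
  shows "\<forall>\<^sub>F \<rho>' in nhds \<rho>. below \<rho>' z f"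
proof -
  define r1 where "r1 = (\<rho> + norm z) / 2"
  have r1: "\<rho> < r1" "r1 < norm z"
    using \<rho> by (auto simp: r1_def)
  have "\<exists>c>0. \<forall>y. r1 \<le> norm y \<and> y \<noteq> z \<longrightarrow> c * norm y powr (2 - real CARD('n)) \<le> f y - kelvin \<rho> f y"
  proof (rule exterior_lower_bound[OF n \<rho>(1) r1 refl])
    show "twice_diff ({y. \<rho> < norm y} - {z}) (\<lambda>y. f y - kelvin \<rho> f y)"
    proof (rule twice_diff_lap_diff(1))
      show "open ({y. \<rho> < norm y} - {z})"
        by (intro open_Diff open_Collect_less continuous_intros closed_singleton)
      show "twice_diff ({y. \<rho> < norm y} - {z}) f"
        by (rule twice_diff_subset[OF f]) auto
      show "twice_diff ({y. \<rho> < norm y} - {z}) (kelvin \<rho> f)"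
        by (rule twice_diff_subset[OF twice_diff_kelvin(1)[OF \<rho> f]]) (use sq_div_less[OF \<rho>] in auto)
    qed
    show "lap (\<lambda>y. f y - kelvin \<rho> f y) y \<le> 0" if "y \<in> {y. \<rho> < norm y} - {z}" for y
      by (rule sup) (use that in auto)
    show "0 \<le> f y - kelvin \<rho> f y" if "y \<in> {y. \<rho> < norm y} - {z}" for y
      using pos[of y] that by auto
    show "0 < f y - kelvin \<rho> f y" if "norm y = r1" for y
      using pos[of y] that r1 by (cases "y = z") auto
  qed
  then obtain c where c: "c > 0"
      "\<And>y. r1 \<le> norm y \<Longrightarrow> y \<noteq> z \<Longrightarrow> c * norm y powr (2 - real CARD('n)) \<le> f y - kelvin \<rho> f y"
    by blast
  show ?thesis
    by (rule below_open[OF n \<rho> f pos c(1) r1(2)])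
      (use c(2) \<rho> r1 rad_pos[OF n \<rho> f sup pos] in \<open>auto simp: add.commute le_diff_eq\<close>)
qed

subsection \<open>Moving spheres for the coupled system\<close>

definition nonlin :: "real \<Rightarrow> real \<Rightarrow> real \<Rightarrow> real \<Rightarrow> real \<Rightarrow> real" where
  "nonlin \<mu> \<beta> q a b = \<mu> * a powr (2 * q + 1) + \<beta> * a powr q * b powr (q + 1)"

lemma nonlin_mono:
  assumes "\<mu> > 0" "\<beta> > 0" "q > 0" "0 \<le> a" "a \<le> a'" "0 \<le> b" "b \<le> b'"
  shows "nonlin \<mu> \<beta> q a b \<le> nonlin \<mu> \<beta> q a' b'"
  using assms unfolding nonlin_def mult.assoc
  by (intro add_mono mult_left_mono mult_mono powr_mono2) auto

lemma nonlin_strict_mono: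
  assumes "\<mu> > 0" "\<beta> > 0" "q > 0" "0 < a" "a \<le> a'" "0 \<le> b" "b < b'"
  shows "nonlin \<mu> \<beta> q a b < nonlin \<mu> \<beta> q a' b'"
proof -
  have "nonlin \<mu> \<beta> q a b < nonlin \<mu> \<beta> q a b'"
    using assms by (simp add: nonlin_def powr_less_mono2)
  also have "\<dots> \<le> nonlin \<mu> \<beta> q a' b'"
    using assms by (intro nonlin_mono) auto
  finally show ?thesis .
qed

lemma nonlin_pos: "\<mu> > 0 \<Longrightarrow> \<beta> > 0 \<Longrightarrow> a > 0 \<Longrightarrow> b > 0 \<Longrightarrow> nonlin \<mu> \<beta> q a b > 0"
  by (simp add: nonlin_def add_pos_pos)

text \<open>The coupling exponents \<open>q\<close> and \<open>q + 1\<close> add up to the exponent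
  of the pure power, so a common Kelvin factor of both components can be pulled out.\<close>

lemma nonlin_scale:
  assumes "k > 0" "a > 0" "b > 0"
  shows "nonlin \<mu> \<beta> q (k * a) (k * b) = k powr (2 * q + 1) * nonlin \<mu> \<beta> q a b"
proof -
  have "(k * a) powr q * (k * b) powr (q + 1) = k powr (2 * q + 1) * (a powr q * b powr (q + 1))"
    using assms powr_add[of k q q] by (simp add: powr_mult powr_add mult_2 mult_ac)
  then show ?thesis
    using assms by (simp add: nonlin_def powr_mult algebra_simps)
qed

definition unbounded_near :: "'a::real_normed_vector \<Rightarrow> ('a \<Rightarrow> real) \<Rightarrow> bool" where
  "unbounded_near z f \<longleftrightarrow> (\<forall>M e. e > 0 \<longrightarrow> (\<exists>y. y \<noteq> z \<and> norm (y - z) < e \<and> f y > M))"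

text \<open>The centre of the spheres is the origin and \<open>z\<close> is the translated
  singularity. The hypotheses are symmetric under exchanging the components, so each statement is
  proved for \<open>u\<close> and obtained for \<open>v\<close> by \<open>swap\<close>.\<close>

locale coupled_system =
  fixes u v :: "real^'n::finite \<Rightarrow> real" and z :: "real^'n" and \<mu>1 \<mu>2 \<beta> q :: real
  assumes n3: "CARD('n) \<ge> 3"
    and coeffs: "\<mu>1 > 0" "\<mu>2 > 0" "\<beta> > 0" "q > 0"
    and subcritical: "(real CARD('n) - 2) * (2 * q + 1) \<le> real CARD('n) + 2"
    and z: "z \<noteq> 0"
    and u_diff: "twice_diff (- {z}) u" and v_diff: "twice_diff (- {z}) v"
    and u_pos: "\<And>x. x \<noteq> z \<Longrightarrow> u x > 0" and v_pos: "\<And>x. x \<noteq> z \<Longrightarrow> v x > 0"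
    and u_eq: "\<And>x. x \<noteq> z \<Longrightarrow> - lap u x = nonlin \<mu>1 \<beta> q (u x) (v x)"
    and v_eq: "\<And>x. x \<noteq> z \<Longrightarrow> - lap v x = nonlin \<mu>2 \<beta> q (v x) (u x)"
begin

lemma swap: "coupled_system v u z \<mu>2 \<mu>1 \<beta> q"
  by unfold_locales
    (use n3 coeffs subcritical z u_diff v_diff u_pos v_pos u_eq v_eq in auto)

lemma u_superharmonic: "x \<noteq> z \<Longrightarrow> lap u x \<le> 0"
  using u_eq[of x] nonlin_pos[OF coeffs(1,3) u_pos v_pos, of x x q] by simp

lemma gap_superharmonic:
  assumes \<rho>: "0 < \<rho>" "\<rho> < norm z" and below: "below \<rho> z u" "below \<rho> z v"
    and y: "\<rho> < norm y" "y \<noteq> z"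
  shows "lap (\<lambda>y. u y - kelvin \<rho> u y) y \<le> 0"
    and "kelvin \<rho> v y < v y \<Longrightarrow> lap (\<lambda>y. u y - kelvin \<rho> u y) y < 0"
proof -
  define m where "m = real CARD('n) - 2"
  define x where "x = (\<rho>\<^sup>2 / (norm y)\<^sup>2) *\<^sub>R y"
  define k where "k = \<rho> / norm y"
  have xz: "x \<noteq> z"
    using inversion_neq[OF \<rho>] y by (simp add: x_def)
  have k: "0 < k" "k \<le> 1"
  proof -
    have "norm y > 0"
      using \<rho> y by linarith
    then show "0 < k" "k \<le> 1"
      using \<rho> y by (simp_all add: k_def divide_le_eq del: zero_less_norm_iff)
  qed
  define E where "E = {y. \<rho>\<^sup>2 / norm z < norm y} - {z}"
  have oE: "open E"
    unfolding E_def by (intro open_Diff open_Collect_less continuous_intros closed_singleton)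
  have yE: "y \<in> E" "\<rho>\<^sup>2 / norm z < norm y"
    using y sq_div_less[OF \<rho>] by (auto simp: E_def)
  have ku: "kelvin \<rho> u y = k powr m * u x" and kv: "kelvin \<rho> v y = k powr m * v x"
    by (simp_all add: kelvin_def k_def m_def x_def)
  have kpos: "0 < kelvin \<rho> u y" "0 < kelvin \<rho> v y"
    unfolding ku kv using k u_pos[OF xz] v_pos[OF xz] by simp_all
  have "lap (kelvin \<rho> u) y = k powr (real CARD('n) + 2) * lap u x"
    using twice_diff_kelvin(2)[OF \<rho> u_diff yE(2)] by (simp add: k_def x_def)
  also have "\<dots> = - (k powr (real CARD('n) + 2) * nonlin \<mu>1 \<beta> q (u x) (v x))"
    using u_eq[OF xz] by (metis minus_minus mult_minus_right)
  finally have 1: "lap (kelvin \<rho> u) y = - (k powr (real CARD('n) + 2) * nonlin \<mu>1 \<beta> q (u x) (v x))" .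
  \<comment> \<open>Since \<open>k \<le> 1\<close>, the larger exponent gives the smaller power;
    this is where subcriticality makes the Kelvin transforms subsolutions of the system.\<close>
  have "k powr (real CARD('n) + 2) \<le> k powr (m * (2 * q + 1))"
    using subcritical k by (intro powr_mono') (auto simp: m_def)
  then have "k powr (real CARD('n) + 2) * nonlin \<mu>1 \<beta> q (u x) (v x)
      \<le> k powr (m * (2 * q + 1)) * nonlin \<mu>1 \<beta> q (u x) (v x)"
    using nonlin_pos[OF coeffs(1,3) u_pos[OF xz] v_pos[OF xz], of q] by (intro mult_right_mono) auto
  also have "\<dots> = nonlin \<mu>1 \<beta> q (kelvin \<rho> u y) (kelvin \<rho> v y)"
    unfolding ku kv using nonlin_scale[of "k powr m" "u x" "v x" \<mu>1 \<beta> q] k u_pos[OF xz] v_pos[OF xz]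
    by (simp add: powr_powr)
  finally have 2: "- lap (kelvin \<rho> u) y \<le> nonlin \<mu>1 \<beta> q (kelvin \<rho> u y) (kelvin \<rho> v y)"
    using 1 by simp
  have "twice_diff E u" "twice_diff E (kelvin \<rho> u)"
    using twice_diff_subset[OF u_diff, of E] twice_diff_subset[OF twice_diff_kelvin(1)[OF \<rho> u_diff], of E]
    by (auto simp: E_def)
  then have 3: "lap (\<lambda>y. u y - kelvin \<rho> u y) y = lap u y - lap (kelvin \<rho> u) y"
    using twice_diff_lap_diff(2)[OF oE _ _ yE(1)] by blast
  have le: "kelvin \<rho> u y \<le> u y" "kelvin \<rho> v y \<le> v y"
    using below y by (auto simp: below_def)
  show "lap (\<lambda>y. u y - kelvin \<rho> u y) y \<le> 0"
    using nonlin_mono[OF coeffs(1,3,4) _ le(1) _ le(2)] kpos 2 3 u_eq[OF y(2)] by simp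
  show "lap (\<lambda>y. u y - kelvin \<rho> u y) y < 0" if "kelvin \<rho> v y < v y"
    using nonlin_strict_mono[OF coeffs(1,3,4) kpos(1) le(1) _ that] kpos(2) 2 3 u_eq[OF y(2)] by simp
qed

text \<open>The exterior of a ball stays connected after removing \<open>z\<close> because the
  dimension is at least 2, so the strong minimum principle spreads positivity from one point to all
  others.\<close>

lemma gap_dichotomy:
  assumes \<rho>: "0 < \<rho>" "\<rho> < norm z" and below: "below \<rho> z u" "below \<rho> z v"
    and a: "\<rho> < norm a" "a \<noteq> z" "kelvin \<rho> u a < u a" and y: "\<rho> < norm y" "y \<noteq> z"
  shows "kelvin \<rho> u y < u y"
proof -
  define E where "E = - cball 0 \<rho> - {z}"
  have E: "x \<in> E \<longleftrightarrow> \<rho> < norm x \<and> x \<noteq> z" for x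
    by (auto simp: E_def)
  have oE: "open E"
    unfolding E_def by (intro open_Diff open_Compl closed_cball closed_singleton)
  have dim: "2 \<le> DIM(real^'n)"
    using n3 by simp
  have "connected (- cball (0::real^'n) \<rho>)"
    by (rule connected_complement_bounded_convex[OF bounded_cball convex_cball dim])
  then have cE: "connected E"
    unfolding E_def by (intro connected_open_delete dim open_Compl closed_cball)
  have "twice_diff E u" "twice_diff E (kelvin \<rho> u)"
    using twice_diff_subset[OF u_diff, of E] twice_diff_subset[OF twice_diff_kelvin(1)[OF \<rho> u_diff], of E]
      sq_div_less[OF \<rho>] by (force simp: E)+
  then have "twice_diff E (\<lambda>y. u y - kelvin \<rho> u y)"
    by (rule twice_diff_lap_diff(1)[OF oE])
  then have "u y - kelvin \<rho> u y > 0"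
    by (rule strong_min_principle[OF n3 oE cE, where a = a])
      (use gap_superharmonic(1)[OF \<rho> below] below a y in \<open>auto simp: E below_def\<close>)
  then show ?thesis by simp
qed

lemma gap_pos_unbounded:
  assumes \<rho>: "0 < \<rho>" "\<rho> < norm z" and below: "below \<rho> z u" "below \<rho> z v"
    and unb: "unbounded_near z u" and y: "\<rho> < norm y" "y \<noteq> z"
  shows "kelvin \<rho> u y < u y"
proof -
  have "(\<rho>\<^sup>2 / (norm z)\<^sup>2) *\<^sub>R z \<noteq> z"
    using inversion_neq[OF \<rho>] \<rho> by simp
  then have "isCont u ((\<rho>\<^sup>2 / (norm z)\<^sup>2) *\<^sub>R z)"
    using isCont_off_point[OF twice_diff_continuous_on[OF u_diff]] by blast
  then have "((\<lambda>y. kelvin \<rho> u y) \<longlongrightarrow> kelvin \<rho> u z) (nhds z)"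
    using \<rho> z by (intro tendsto_kelvin tendsto_const) (auto simp: filterlim_def)
  then have "\<forall>\<^sub>F y in nhds z. kelvin \<rho> u y < kelvin \<rho> u z + 1"
    by (rule order_tendstoD) simp
  then obtain d where d: "d > 0" "\<And>y. norm (y - z) < d \<Longrightarrow> kelvin \<rho> u y < kelvin \<rho> u z + 1"
    unfolding eventually_nhds_metric dist_norm by blast
  \<comment> \<open>The second bound keeps the point \<open>a\<close> outside the sphere.\<close>
  have "min d (norm z - \<rho>) > 0"
    using d \<rho> by simp
  then obtain a where a: "a \<noteq> z" "norm (a - z) < min d (norm z - \<rho>)" "u a > kelvin \<rho> u z + 1"
    using unb unfolding unbounded_near_def by blast
  have "\<rho> < norm a"
    using a(2) norm_triangle_ineq2[of z a] by (simp add: norm_minus_commute)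
  moreover have "kelvin \<rho> u a < u a"
    using d(2)[of a] a by simp
  ultimately show ?thesis
    using gap_dichotomy[OF \<rho> below _ a(1) _ y] by blast
qed

text \<open>A single zero of the gap of \<open>u\<close> makes it vanish identically, so its
  Laplacian is 0; but the strict gap of \<open>v\<close> makes that Laplacian negative through the
  coupling term.\<close>

lemma gap_pos_other:
  assumes \<rho>: "0 < \<rho>" "\<rho> < norm z" and below: "below \<rho> z u" "below \<rho> z v"
    and pos: "\<And>y. \<rho> < norm y \<Longrightarrow> y \<noteq> z \<Longrightarrow> kelvin \<rho> v y < v y"
    and y: "\<rho> < norm y" "y \<noteq> z"
  shows "kelvin \<rho> u y < u y"
proof (rule ccontr)
  assume not: "\<not> kelvin \<rho> u y < u y"
  have eq: "u x - kelvin \<rho> u x = 0" if "x \<in> {x. \<rho> < norm x} - {z}" for x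
  proof (rule ccontr)
    assume "u x - kelvin \<rho> u x \<noteq> 0"
    moreover have "kelvin \<rho> u x \<le> u x"
      using below that by (auto simp: below_def)
    ultimately show False
      using gap_dichotomy[OF \<rho> below, of x y] that y not by auto
  qed
  have "lap (\<lambda>y. u y - kelvin \<rho> u y) y = lap (\<lambda>y. 0) y"
    by (rule lap_cong[where S = "{x. \<rho> < norm x} - {z}"])
      (use y eq in \<open>auto intro!: open_Diff open_Collect_less continuous_intros\<close>)
  then show False
    using gap_superharmonic(2)[OF \<rho> below y pos[OF y]] by (simp add: lap_const)
qed

text \<open>A connectedness argument in the radius: the admissible and the inadmissible radii are
  both open in the interval up to \<open>norm z\<close>, and small radii are admissible.\<close>

lemma below_all:
  assumes unb: "unbounded_near z u \<or> unbounded_near z v" and \<rho>: "0 < \<rho>" "\<rho> < norm z"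
  shows "below \<rho> z u \<and> below \<rho> z v"
proof -
  interpret S: coupled_system v u z \<mu>2 \<mu>1 \<beta> q
    by (rule swap)
  define I where "I = {0<..<norm z}"
  define G where "G = {\<rho>. below \<rho> z u \<and> below \<rho> z v}"
  have 1: "\<forall>\<^sub>F \<rho>' in nhds \<rho>. \<rho>' \<in> I \<inter> G" if "\<rho> \<in> I \<inter> G" for \<rho>
  proof -
    have \<rho>: "0 < \<rho>" "\<rho> < norm z" and below: "below \<rho> z u" "below \<rho> z v"
      using that by (auto simp: I_def G_def)
    have "(\<forall>y. \<rho> < norm y \<and> y \<noteq> z \<longrightarrow> kelvin \<rho> u y < u y) \<and> (\<forall>y. \<rho> < norm y \<and> y \<noteq> z \<longrightarrow> kelvin \<rho> v y < v y)"
      using unb gap_pos_unbounded[OF \<rho> below] S.gap_pos_unbounded[OF \<rho> below(2,1)]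
        gap_pos_other[OF \<rho> below] S.gap_pos_other[OF \<rho> below(2,1)] by blast
    then have "\<forall>\<^sub>F \<rho>' in nhds \<rho>. below \<rho>' z u" "\<forall>\<^sub>F \<rho>' in nhds \<rho>. below \<rho>' z v"
      using gap_open[OF n3 \<rho> u_diff gap_superharmonic(1)[OF \<rho> below]]
        gap_open[OF n3 \<rho> v_diff S.gap_superharmonic(1)[OF \<rho> below(2,1)]] by blast+
    moreover have "\<forall>\<^sub>F \<rho>' in nhds \<rho>. \<rho>' \<in> I"
      using \<rho> by (intro eventually_nhds_in_open) (auto simp: I_def)
    ultimately show ?thesis
      by eventually_elim (simp add: G_def)
  qed
  have 2: "\<forall>\<^sub>F \<rho>' in nhds \<rho>. \<rho>' \<in> I - G" if "\<rho> \<in> I - G" for \<rho>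
  proof -
    have \<rho>: "0 < \<rho>" "\<rho> < norm z" and "\<not> below \<rho> z u \<or> \<not> below \<rho> z v"
      using that by (auto simp: I_def G_def)
    then have "(\<forall>\<^sub>F \<rho>' in nhds \<rho>. \<not> below \<rho>' z u) \<or> (\<forall>\<^sub>F \<rho>' in nhds \<rho>. \<not> below \<rho>' z v)"
      using not_below_open[OF \<rho> twice_diff_continuous_on[OF u_diff]]
        not_below_open[OF \<rho> twice_diff_continuous_on[OF v_diff]] by blast
    then have "\<forall>\<^sub>F \<rho>' in nhds \<rho>. \<rho>' \<notin> G"
      by (auto simp: G_def elim: eventually_mono)
    moreover have "\<forall>\<^sub>F \<rho>' in nhds \<rho>. \<rho>' \<in> I"
      using \<rho> by (intro eventually_nhds_in_open) (auto simp: I_def)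
    ultimately show ?thesis
      by eventually_elim simp
  qed
  obtain a b where ab: "a > 0" "b > 0" "\<And>\<rho>. 0 < \<rho> \<Longrightarrow> \<rho> < a \<Longrightarrow> below \<rho> z u" "\<And>\<rho>. 0 < \<rho> \<Longrightarrow> \<rho> < b \<Longrightarrow> below \<rho> z v"
    using below_small[OF n3 z u_diff u_superharmonic u_pos] below_small[OF n3 z v_diff S.u_superharmonic v_pos]
    by metis
  obtain r where r: "0 < r" "r < min (min a b) (norm z)"
    using ab z dense[of 0 "min (min a b) (norm z)"] by auto
  then have "r \<in> I \<inter> G"
    using ab by (auto simp: I_def G_def)
  moreover have "open (I \<inter> G)" "open (I - G)"
    using 1 2 by (metis eventually_nhds openI open_subopen subsetI)+
  moreover have "connected I"
    by (simp add: I_def)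
  ultimately have "I - G = {}"
    using connectedD[of I "I \<inter> G" "I - G"] by blast
  then show ?thesis
    using \<rho> by (auto simp: I_def G_def)
qed

end

subsection \<open>Symmetry\<close>

lemma Limsup_infinite_unbounded_near:
  fixes f :: "real^'n::finite \<Rightarrow> real"
  assumes "Limsup (at 0) (\<lambda>x. ereal (f x)) = \<infinity>"
  shows "unbounded_near (- x) (\<lambda>y. f (y + x))"
  unfolding unbounded_near_def
proof (intro allI impI)
  fix M e :: real assume e: "e > 0"
  have "\<not> (\<forall>\<^sub>F y in at 0. ereal (f y) \<le> ereal M)"
    using Limsup_bounded[of "\<lambda>x. ereal (f x)" "ereal M" "at 0"] assms by auto
  then obtain y where "y \<noteq> 0" "norm y < e" "f y > M"
    using e by (auto simp: eventually_at dist_norm not_le)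
  then show "\<exists>y. y \<noteq> - x \<and> norm (y - - x) < e \<and> f (y + x) > M"
    by (intro exI[of _ "y - x"]) (auto simp: eq_neg_iff_add_eq_0)
qed

lemma dim_ineqs:
  assumes n3: "CARD('n::finite) \<ge> 3"
    and p_low: "real CARD('n) / (real CARD('n) - 2) < 2 * q + 1"
    and p_up: "2 * q + 1 \<le> (real CARD('n) + 2) / (real CARD('n) - 2)"
  shows "q > 0" "(real CARD('n) - 2) * (2 * q + 1) \<le> real CARD('n) + 2"
proof -
  have m: "real CARD('n) - 2 > 0"
    using n3 by simp
  have "1 < real CARD('n) / (real CARD('n) - 2)"
    using m by (simp add: less_divide_eq)
  then show "q > 0"
    using p_low by linarith
  show "(real CARD('n) - 2) * (2 * q + 1) \<le> real CARD('n) + 2"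
    using p_up m by (simp add: le_divide_eq mult.commute)
qed

text \<open>The sphere with centre \<open>x = b + t *\<^sub>R (b - a)\<close> and radius \<open>sqrt (t * (t + 1)) * norm (b - a)\<close>
  excludes the origin and its inversion maps \<open>a\<close> to \<open>b\<close>; as \<open>t\<close> grows the Kelvin factor tends to 1.\<close>

lemma monotone_of_spheres:
  fixes u :: "real^'n::finite \<Rightarrow> real"
  assumes spheres: "\<And>x \<rho>. x \<noteq> 0 \<Longrightarrow> 0 < \<rho> \<Longrightarrow> \<rho> < norm x \<Longrightarrow> below \<rho> (- x) (\<lambda>y. u (y + x))"
    and ab: "0 < norm a" "norm a < norm b"
  shows "u b \<le> u a"
proof -
  define m where "m = real CARD('n) - 2"
  define e where "e = b - a"
  define d where "d = norm e"
  have d: "d > 0"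
    using ab by (auto simp: d_def e_def)
  have main: "sqrt (t / (t + 1)) powr m * u b \<le> u a" if t: "t > 0" for t
  proof -
    define x where "x = b + t *\<^sub>R e"
    \<comment> \<open>The distances of \<open>b\<close> and \<open>a\<close> from \<open>x\<close>
      are \<open>t * d\<close> and \<open>(t + 1) * d\<close>, on the same ray; their product is
      \<open>\<rho>\<^sup>2\<close>. As \<open>t\<close> grows the spheres flatten to the
      perpendicular bisector of \<open>a\<close> and \<open>b\<close>.\<close>
    define \<rho> where "\<rho> = sqrt (t * (t + 1)) * d"
    have \<rho>: "\<rho> > 0"
      using t d by (simp add: \<rho>_def)
    have sq: "\<rho>\<^sup>2 = t * (t + 1) * d\<^sup>2"
      using t by (simp add: \<rho>_def power_mult_distrib)
    \<comment> \<open>Positivity of this difference places the origin outside the sphere; it rests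
      on \<open>norm a < norm b\<close>, which keeps the coefficient of \<open>t\<close>
      nonnegative.\<close>
    have "(norm x)\<^sup>2 - \<rho>\<^sup>2 = (norm b)\<^sup>2 + t * ((norm b)\<^sup>2 - (norm a)\<^sup>2)"
      unfolding sq x_def d_def e_def power2_norm_eq_inner
      by (simp add: inner_add_left inner_add_right inner_diff_left inner_diff_right inner_commute algebra_simps power2_eq_square)
    also have "\<dots> > 0"
    proof (rule add_pos_nonneg)
      show "(norm b)\<^sup>2 > 0"
        using ab by auto
      have "(norm a)\<^sup>2 \<le> (norm b)\<^sup>2"
        using ab by (intro power_mono) auto
      then show "0 \<le> t * ((norm b)\<^sup>2 - (norm a)\<^sup>2)"
        using t by simp
    qed
    finally have less: "\<rho> < norm x"
      using power2_less_imp_less[of \<rho> "norm x"] by simp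
    have x0: "x \<noteq> 0"
      using less \<rho> by auto
    have ax: "a - x = - ((t + 1) *\<^sub>R e)"
      by (simp add: x_def e_def algebra_simps)
    have nax: "norm (a - x) = (t + 1) * d"
      unfolding ax using t by (simp add: d_def)
    have k: "\<rho> / norm (a - x) = sqrt (t / (t + 1))"
    proof -
      have "(t + 1) / sqrt (t + 1) = sqrt (t + 1)"
        using t by (intro real_div_sqrt) simp
      then have "sqrt (t * (t + 1)) = sqrt (t / (t + 1)) * (t + 1)"
        by (simp add: real_sqrt_mult real_sqrt_divide flip: times_divide_eq_right)
      then show ?thesis
        unfolding nax \<rho>_def using t d by simp
    qed
    have "\<rho> \<le> norm (a - x)"
    proof -
      have "sqrt (t / (t + 1)) \<le> 1"
        using t by simp
      then show ?thesis
        unfolding k[symmetric] using t d nax by (simp add: divide_le_eq)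
    qed
    moreover have "a - x \<noteq> - x"
      using ab by auto
    ultimately have "kelvin \<rho> (\<lambda>y. u (y + x)) (a - x) \<le> u (a - x + x)"
      using spheres[OF x0 \<rho> less] by (auto simp: below_def)
    moreover have "(\<rho>\<^sup>2 / (norm (a - x))\<^sup>2) *\<^sub>R (a - x) + x = b"
    proof -
      have "\<rho>\<^sup>2 / (norm (a - x))\<^sup>2 = t / (t + 1)"
        using k t by (simp add: flip: power_divide)
      then have "(\<rho>\<^sup>2 / (norm (a - x))\<^sup>2) *\<^sub>R (a - x) = - (t *\<^sub>R e)"
        unfolding ax using t by simp
      then show ?thesis
        by (simp add: x_def)
    qed
    ultimately show ?thesis
      using k by (simp add: kelvin_def m_def)
  qed
  have le: "sqrt (real n / real (Suc n)) powr m * u b \<le> u a" if "n \<ge> 1" for n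
    using main[of "real n"] that by (simp add: add.commute)
  have "(\<lambda>n. sqrt (real n / real (Suc n)) powr m * u b) \<longlonglongrightarrow> sqrt 1 powr m * u b"
    by (intro tendsto_intros LIMSEQ_n_over_Suc_n) auto
  then show ?thesis
    using le LIMSEQ_le_const2[of _ "sqrt 1 powr m * u b" "u a"] by fastforce
qed

lemma radial_of_monotone:
  fixes u :: "real^'n::finite \<Rightarrow> real"
  assumes cont: "continuous_on (- {0}) u" and sup: "\<And>x. x \<noteq> 0 \<Longrightarrow> lap u x < 0"
    and mono: "\<And>a b. 0 < norm a \<Longrightarrow> norm a < norm b \<Longrightarrow> u b \<le> u a"
  shows "x \<noteq> 0 \<Longrightarrow> norm x = norm y \<Longrightarrow> u x = u y"
    and "0 < norm x \<Longrightarrow> norm x < norm y \<Longrightarrow> u y < u x"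
proof -
  have *: "u y \<le> u x" if "x \<noteq> 0" "norm x = norm y" for x y
  proof -
    have "y \<noteq> 0" using that by auto
    \<comment> \<open>Pushing \<open>y\<close> slightly outwards makes its norm strictly larger than
      that of \<open>x\<close>, so \<open>mono\<close> applies before the limit is taken.\<close>
    have "(\<lambda>n. (1 + 1 / real (Suc n)) *\<^sub>R y) \<longlonglongrightarrow> (1 + 0) *\<^sub>R y"
      by (intro tendsto_intros LIMSEQ_Suc lim_1_over_n)
    then have "(\<lambda>n. u ((1 + 1 / real (Suc n)) *\<^sub>R y)) \<longlonglongrightarrow> u y"
      using isCont_tendsto_compose[OF isCont_off_point[OF cont \<open>y \<noteq> 0\<close>]] by simp
    moreover have "u ((1 + 1 / real (Suc n)) *\<^sub>R y) \<le> u x" for n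
    proof (rule mono)
      have "1 * norm y < (1 + 1 / real (Suc n)) * norm y"
        using \<open>y \<noteq> 0\<close> by (intro mult_strict_right_mono) auto
      also have "\<dots> = norm ((1 + 1 / real (Suc n)) *\<^sub>R y)"
        by simp
      finally show "norm x < norm ((1 + 1 / real (Suc n)) *\<^sub>R y)"
        using that by simp
    qed (use that \<open>y \<noteq> 0\<close> in simp)
    ultimately show ?thesis
      by (intro LIMSEQ_le_const2) auto
  qed
  show "u x = u y" if "x \<noteq> 0" "norm x = norm y"
    using *[of x y] *[of y x] that by force
  show "u y < u x" if xy: "0 < norm x" "norm x < norm y"
  proof (rule ccontr)
    assume "\<not> u y < u x"
    define S where "S = {w::real^'n. norm x < norm w \<and> norm w < norm y}"
    \<comment> \<open>Monotonicity squeezes \<open>u w\<close> between \<open>u y\<close> and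
      \<open>u x\<close>, which coincide if strictness fails.\<close>
    have const: "u w = u x" if "w \<in> S" for w
      using mono[of x w] mono[of w y] that xy \<open>\<not> u y < u x\<close> by (force simp: S_def)
    obtain w :: "real^'n" where "norm w = (norm x + norm y) / 2"
      using vector_choose_size[of "(norm x + norm y) / 2"] by auto
    then have w: "w \<in> S"
      using xy by (simp add: S_def)
    have "open S"
      unfolding S_def by (intro open_Collect_conj open_Collect_less continuous_intros)
    then have "lap u w = lap (\<lambda>w. u x) w"
      by (rule lap_cong[OF _ w const])
    moreover have "w \<noteq> 0"
      using w xy by (auto simp: S_def)
    ultimately show False
      using sup[of w] by (simp add: lap_const)
  qed
qed

theorem theorem2p1:
  fixes u v :: "real^'n \<Rightarrow> real" and \<mu>1 \<mu>2 \<beta> q :: real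
  assumes n3: "CARD('n) \<ge> 3"
    and pos: "\<mu>1 > 0" "\<mu>2 > 0" "\<beta> > 0"
    and p_low: "real CARD('n) / (real CARD('n) - 2) < 2 * q + 1"
    and p_up: "2 * q + 1 \<le> (real CARD('n) + 2) / (real CARD('n) - 2)"
    and C2: "C2_on (UNIV - {0}) u" "C2_on (UNIV - {0}) v"
    and upos: "\<And>x. x \<noteq> 0 \<Longrightarrow> u x > 0"
    and vpos: "\<And>x. x \<noteq> 0 \<Longrightarrow> v x > 0"
    and eq1: "\<And>x. x \<noteq> 0 \<Longrightarrow>
       - lap u x = \<mu>1 * u x powr (2 * q + 1) + \<beta> * u x powr q * v x powr (q + 1)"
    and eq2: "\<And>x. x \<noteq> 0 \<Longrightarrow>
       - lap v x = \<mu>2 * v x powr (2 * q + 1) + \<beta> * v x powr q * u x powr (q + 1)"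
    and sing: "Limsup (at 0) (\<lambda>x. ereal (u x)) = \<infinity> \<or> Limsup (at 0) (\<lambda>x. ereal (v x)) = \<infinity>"
  shows "(\<forall>x y. x \<noteq> 0 \<and> norm x = norm y \<longrightarrow> u x = u y \<and> v x = v y)
       \<and> (\<forall>x y. 0 < norm x \<and> norm x < norm y \<longrightarrow> u y < u x \<and> v y < v x)"
proof -
  note q = dim_ineqs[OF n3 p_low p_up]
  have o: "open (- {0::real^'n})"
    by (rule open_Compl) simp
  have td: "twice_diff (- {0}) u" "twice_diff (- {0}) v"
    using C2_on_imp_twice_diff[OF o] C2 by (simp_all add: Compl_eq_Diff_UNIV)
  have eqs: "- lap u x = nonlin \<mu>1 \<beta> q (u x) (v x)" "- lap v x = nonlin \<mu>2 \<beta> q (v x) (u x)" if "x \<noteq> 0" for x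
    using eq1[OF that] eq2[OF that] by (simp_all add: nonlin_def)
  have neg: "lap u x < 0" "lap v x < 0" if "x \<noteq> 0" for x
    using eqs[OF that] nonlin_pos[OF pos(1,3) upos vpos, OF that that, of q]
      nonlin_pos[OF pos(2,3) vpos upos, OF that that, of q] by simp_all
  have spheres: "below \<rho> (- x) (\<lambda>y. u (y + x)) \<and> below \<rho> (- x) (\<lambda>y. v (y + x))"
    if x: "x \<noteq> 0" and \<rho>: "0 < \<rho>" "\<rho> < norm x" for x \<rho>
  proof -
    have nz: "y + x \<noteq> 0" if "y \<noteq> - x" for y
      using that by (simp add: eq_neg_iff_add_eq_0)
    have iff: "y \<in> - {- x} \<longleftrightarrow> y + x \<in> - {0}" for y
      by (simp add: eq_neg_iff_add_eq_0)
    note su = twice_diff_lap_shift[OF o td(1) iff] and sv = twice_diff_lap_shift[OF o td(2) iff]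
    \<comment> \<open>The translation moves the centre \<open>x\<close> to the origin and the
      singularity from the origin to \<open>- x\<close>.\<close>
    interpret coupled_system "\<lambda>y. u (y + x)" "\<lambda>y. v (y + x)" "- x" \<mu>1 \<mu>2 \<beta> q
      by unfold_locales
        (use n3 pos q x su sv nz upos vpos eqs in auto)
    show ?thesis
      by (rule below_all) (use sing Limsup_infinite_unbounded_near \<rho> in auto)
  qed
  note u_rad = radial_of_monotone[OF twice_diff_continuous_on[OF td(1)] neg(1) monotone_of_spheres]
    and v_rad = radial_of_monotone[OF twice_diff_continuous_on[OF td(2)] neg(2) monotone_of_spheres]
  show ?thesis
    using u_rad v_rad spheres by blast
qed

end
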